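(* Let $f_{\tau}$ be the density of the distribution of the trace function $\tau(m)=\mathrm{Trace}\, m$ on $G=\mathrm{USp}_4$. If $x\in\mathbb{R}$ and $|x|<4$, then, with $m=1-\frac{x^2}{16}$, $$\frac{15}{64}\,\pi^{2} f_{\tau}(x)=(m^{2}-16m+16)\,E(m)-8(m^{2}-3m+2)\,K(m),$$ where for $x=0$ (i.e. $m=1$) the term $(m^2-3m+2)K(m)$ is understood as its limit $0$ as $m\to1^-$.
   Context: $\mathrm{USp}_{4}=\{m\in \mathrm{GL}_{4}(\mathbb{C}) : {}^t m J m=J,\ {}^t m\,\bar m=I_{4}\}$ with $J=\begin{pmatrix}0&I_2\\-I_2&0\end{pmatrix}$, equipped with the Haar measure $dm$ of total mass $1$. The trace $\tau(m)=\mathrm{Trace}\, m$ is real with values in $[-4,4]$; its distribution is the image of $dm$ under $\tau$, and $f_\tau$ denotes the continuous density of this distribution: $\int_G\varphi(\tau(m))\,dm=\int_{-4}^{4}\varphi(x)f_\tau(x)\,dx$ for every continuous $\varphi$ on $[-4,4]$. The Legendre elliptic integrals are, as functions of the parameter $m$, $$K(m)=\int_0^{\pi/2}\frac{d\varphi}{\sqrt{1-m\sin^2\varphi}},\qquad E(m)=\int_0^{\pi/2}\sqrt{1-m\sin^2\varphi}\,d\varphi.$$ *)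

theory Defs
  imports "HOL-Probability.Probability"
begin

(* The block matrix (0, I; -I, 0) with 2x2 blocks. Type 4 has the elements 1, 2, 3, 4 (with 4 = 0). *)
definition J4 :: "complex^4^4" where
  "J4 = (\<chi> i j. if (i, j) \<in> {(1, 3), (2, 4)} then 1
                 else if (i, j) \<in> {(3, 1), (4, 2)} then -1 else 0)"

definition USp4 :: "(complex^4^4) set" where
  "USp4 = {m. invertible m \<and> transpose m ** J4 ** m = J4 \<and>
              transpose m ** map_matrix cnj m = mat 1}"

(* M is the Haar measure of total mass 1 of the compact matrix group G: a Borel probability
   measure on G invariant under left translations. *)
definition is_normalized_haar :: "(complex^'n^'n) set \<Rightarrow> (complex^'n^'n) measure \<Rightarrow> bool" where
  "is_normalized_haar G M \<longleftrightarrow>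
     prob_space M \<and> sets M = sets (restrict_space borel G) \<and>
     (\<forall>g\<in>G. distr M M (\<lambda>m. g ** m) = M)"

(* The trace is real on USp4 (trace_USp4_real below), so taking Re only changes the type. *)
definition tau :: "complex^4^4 \<Rightarrow> real" where
  "tau m = Re (trace m)"

(* f is the continuous density, on [-4,4], of the image of M under tau. *)
definition is_trace_density :: "(complex^4^4) measure \<Rightarrow> (real \<Rightarrow> real) \<Rightarrow> bool" where
  "is_trace_density M f \<longleftrightarrow>
     continuous_on {-4..4} f \<and>
     (\<forall>\<phi> :: real \<Rightarrow> real. continuous_on {-4..4} \<phi> \<longrightarrow>
        (\<integral>m. \<phi> (tau m) \<partial>M) = integral {-4..4} (\<lambda>x. \<phi> x * f x))"

(* Both take the parameter m, not the modulus k with m = k^2. *)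
definition ellipticK :: "real \<Rightarrow> real" where
  "ellipticK m = integral {0..pi/2} (\<lambda>t. 1 / sqrt (1 - m * (sin t)\<^sup>2))"

definition ellipticE :: "real \<Rightarrow> real" where
  "ellipticE m = integral {0..pi/2} (\<lambda>t. sqrt (1 - m * (sin t)\<^sup>2))"

(* (m^2 - 3 m + 2) K(m) for m < 1; at m = 1, where the integral K diverges, its limit from the
   left, which is 0 by tendsto_ellipticK_term below. *)
definition ellipticK_term :: "real \<Rightarrow> real" where
  "ellipticK_term m = (if m = 1 then 0 else (m\<^sup>2 - 3 * m + 2) * ellipticK m)"

lemma J4_nth:
  "J4 $ 1 $ 1 = 0" "J4 $ 1 $ 2 = 0" "J4 $ 1 $ 3 = 1" "J4 $ 1 $ 4 = 0"
  "J4 $ 2 $ 1 = 0" "J4 $ 2 $ 2 = 0" "J4 $ 2 $ 3 = 0" "J4 $ 2 $ 4 = 1"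
  "J4 $ 3 $ 1 = -1" "J4 $ 3 $ 2 = 0" "J4 $ 3 $ 3 = 0" "J4 $ 3 $ 4 = 0"
  "J4 $ 4 $ 1 = 0" "J4 $ 4 $ 2 = -1" "J4 $ 4 $ 3 = 0" "J4 $ 4 $ 4 = 0"
  by (simp_all add: J4_def)

lemma J4_square: "J4 ** (- J4) = mat 1"
  by (simp add: vec_eq_iff forall_4 matrix_matrix_mult_def sum_4 J4_nth mat_def)

lemma trace_USp4_real:
  assumes "m \<in> USp4"
  shows "trace m \<in> \<real>"
proof -
  let ?c = "map_matrix cnj m"
  have J: "transpose m ** J4 ** m = J4" and U: "transpose m ** ?c = mat 1"
    using assms by (auto simp: USp4_def)
  have U': "?c ** transpose m = mat 1"
    using U matrix_left_right_inverse by blast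
  have "J4 ** m = ?c ** transpose m ** J4 ** m"
    by (simp add: U')
  also have "\<dots> = ?c ** J4"
    using J by (metis matrix_mul_assoc)
  finally have eq: "J4 ** m = ?c ** J4" .
  have "trace m = trace (m ** (J4 ** (- J4)))"
    by (simp add: J4_square)
  also have "\<dots> = trace (- J4 ** (m ** J4))"
    by (metis matrix_mul_assoc trace_mul_sym)
  also have "\<dots> = trace (J4 ** m ** (- J4))"
    by (metis J4_square matrix_left_right_inverse matrix_mul_assoc matrix_mul_lid trace_mul_sym)
  also have "\<dots> = trace (?c ** (J4 ** (- J4)))"
    by (simp add: eq matrix_mul_assoc)
  also have "\<dots> = cnj (trace m)"
    by (simp add: J4_square trace_def)
  finally show ?thesis
    by (metis Reals_cnj_iff)
qed

lemma tau_USp4_range: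
  assumes "m \<in> USp4"
  shows "tau m \<in> {-4..4}"
proof -
  have U: "transpose m ** map_matrix cnj m = mat 1"
    using assms by (auto simp: USp4_def)
  have le: "norm (m $ i $ i) \<le> 1" for i
  proof -
    have "(\<Sum>k\<in>UNIV. m $ k $ i * cnj (m $ k $ i)) = 1"
      using arg_cong[OF U, of "\<lambda>A. A $ i $ i"]
      by (simp add: matrix_matrix_mult_def transpose_def mat_def)
    then have "complex_of_real (\<Sum>k\<in>UNIV. (norm (m $ k $ i))\<^sup>2) = complex_of_real 1"
      by (simp del: of_real_power add: complex_norm_square)
    then have s: "(\<Sum>k\<in>UNIV. (norm (m $ k $ i))\<^sup>2) = 1"
      by (simp only: of_real_eq_iff)
    have "(norm (m $ i $ i))\<^sup>2 \<le> (\<Sum>k\<in>UNIV. (norm (m $ k $ i))\<^sup>2)"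
      by (rule member_le_sum) auto
    with s show ?thesis
      by (simp add: power_le_one_iff abs_square_le_1)
  qed
  have "norm (trace m) \<le> (\<Sum>i\<in>(UNIV :: 4 set). norm (m $ i $ i))"
    unfolding trace_def by (rule norm_sum)
  also have "\<dots> \<le> (\<Sum>i\<in>(UNIV :: 4 set). 1)"
    by (intro sum_mono le)
  finally have "norm (trace m) \<le> 4" by simp
  then have "\<bar>tau m\<bar> \<le> 4"
    unfolding tau_def using abs_Re_le_cmod order_trans by blast
  then show ?thesis by auto
qed

lemma tendsto_ellipticK_term:
  "((\<lambda>m. (m\<^sup>2 - 3 * m + 2) * ellipticK m) \<longlongrightarrow> 0) (at_left 1)"
proof (rule Lim_null_comparison)
  have bound: "norm ((m\<^sup>2 - 3 * m + 2) * ellipticK m) \<le> (2 - m) * sqrt (1 - m) * (pi / 2)"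
    if m: "0 < m" "m < 1" for m :: real
  proof -
    have pos: "1 - m \<le> 1 - m * (sin t)\<^sup>2" for t
      using m by (simp add: mult_le_cancel_left1 abs_square_le_1)
    have "norm (ellipticK m) \<le> 1 / sqrt (1 - m) * (pi / 2 - 0)"
      unfolding ellipticK_def
    proof (rule integral_bound)
      have "1 - m * (sin t)\<^sup>2 > 0" for t using pos[of t] m by linarith
      then have nz: "sqrt (1 - m * (sin t)\<^sup>2) \<noteq> 0" for t
        by (metis less_irrefl real_sqrt_gt_zero)
      show "continuous_on {0..pi/2} (\<lambda>t. 1 / sqrt (1 - m * (sin t)\<^sup>2))"
        by (intro continuous_intros) (use nz in auto)
      show "norm (1 / sqrt (1 - m * (sin t)\<^sup>2)) \<le> 1 / sqrt (1 - m)" if "t \<in> {0..pi/2}" for t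
      proof -
        have "0 < sqrt (1 - m)" using m by simp
        moreover have "sqrt (1 - m) \<le> sqrt (1 - m * (sin t)\<^sup>2)" using pos by simp
        ultimately show ?thesis by (simp add: frac_le)
      qed
    qed simp
    then have K: "norm (ellipticK m) \<le> 1 / sqrt (1 - m) * (pi / 2)" by simp
    have f: "m\<^sup>2 - 3 * m + 2 = (2 - m) * (1 - m)" by (simp add: power2_eq_square algebra_simps)
    have "norm ((m\<^sup>2 - 3 * m + 2) * ellipticK m) = (2 - m) * (1 - m) * norm (ellipticK m)"
      using m by (simp add: f abs_mult)
    also have "\<dots> \<le> (2 - m) * (1 - m) * (1 / sqrt (1 - m) * (pi / 2))"
      using m K by (intro mult_left_mono) auto
    also have "\<dots> = (2 - m) * ((1 - m) / sqrt (1 - m)) * (pi / 2)" by simp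
    also have "(1 - m) / sqrt (1 - m) = sqrt (1 - m)"
      using m by (simp add: real_div_sqrt)
    finally show ?thesis .
  qed
  show "\<forall>\<^sub>F m in at_left 1. norm ((m\<^sup>2 - 3 * m + 2) * ellipticK m)
          \<le> (2 - m) * sqrt (1 - m) * (pi / 2)"
    by (rule eventually_mono[OF eventually_at_left_real[of 0 "1::real"]])
      (simp, rule bound, simp_all only: greaterThanLessThan_iff)
  have "((\<lambda>m::real. (2 - m) * sqrt (1 - m) * (pi / 2)) \<longlongrightarrow> (2 - 1) * sqrt (1 - 1) * (pi / 2)) (at_left 1)"
    by (intro tendsto_intros)
  then show "((\<lambda>m::real. (2 - m) * sqrt (1 - m) * (pi / 2)) \<longlongrightarrow> 0) (at_left 1)" by simp
qed

end

theory Submission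
  imports Defs "HOL-Real_Asymp.Real_Asymp"
begin

text \<open>Let \<open>a = tr g\<close> and \<open>b = tr g\<^sup>2\<close>. Left invariance of the Haar measure gives \<open>\<integral> XF = 0\<close> for
  every \<open>X\<close> in the Lie algebra and every polynomial \<open>F\<close>. Summed over a basis, \<open>F = tr (X g) a\<^sup>n\<close>
  and \<open>F = tr (X g\<^sup>2) a\<^sup>n\<close> yield, by the completeness relation of the basis and since \<open>tr g\<^sup>3\<close> is a
  polynomial in \<open>a, b\<close>, two linear relations between \<open>\<integral> a\<^bsup>n+2\<^esup>\<close>, \<open>\<integral> a\<^sup>n\<close> and \<open>\<integral> a\<^sup>n b\<close>. Eliminating
  the last one leaves \<open>(n + 6) (n + 8) \<integral> a\<^bsup>n+2\<^esup> = 16 (n + 1) (n + 3) \<integral> a\<^sup>n\<close>, which determines all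
  moments of the trace. The differential equations of the elliptic integrals give the same
  recurrence for the moments of the right-hand side, and Wallis' product gives its total mass. A
  continuous function on a compact interval is determined by its moments.\<close>

section \<open>The Lie algebra of the compact symplectic group\<close>

text \<open>Explicit matrices are entered as lists of rows. The index type has the elements 1, 2, 3
  and 4 = 0, so positions in these lists need a translation.\<close>

definition ix4 :: "4 \<Rightarrow> nat" where
  "ix4 i = (if i = 1 then 0 else if i = 2 then 1 else if i = 3 then 2 else 3)"

definition mat4 :: "'a list list \<Rightarrow> 'a^4^4" where
  "mat4 xs = (\<chi> i j. xs ! ix4 i ! ix4 j)"

lemma ix4_simps [simp]: "ix4 1 = 0" "ix4 2 = 1" "ix4 3 = 2" "ix4 4 = 3"
  by (simp_all add: ix4_def)

lemma mat4_nth [simp]: "mat4 xs $ i $ j = xs ! ix4 i ! ix4 j"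
  by (simp add: mat4_def)

text \<open>A basis of the Lie algebra, orthonormal up to scaling. Each element squares to \<open>-1\<close>, so
  that its one-parameter group is \<open>cos t + sin t X\<close>, see \<open>rotation\<close> below.\<close>

definition usp4_basis :: "(complex^4^4) list" where
  "usp4_basis = map mat4
    [[[\<i>, 0, 0, 0], [0, \<i>, 0, 0], [0, 0, -\<i>, 0], [0, 0, 0, -\<i>]],
     [[\<i>, 0, 0, 0], [0, -\<i>, 0, 0], [0, 0, -\<i>, 0], [0, 0, 0, \<i>]],
     [[0, \<i>, 0, 0], [\<i>, 0, 0, 0], [0, 0, 0, -\<i>], [0, 0, -\<i>, 0]],
     [[0, 1, 0, 0], [-1, 0, 0, 0], [0, 0, 0, 1], [0, 0, -1, 0]],
     [[0, 0, 1, 0], [0, 0, 0, 1], [-1, 0, 0, 0], [0, -1, 0, 0]],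
     [[0, 0, 0, 1], [0, 0, 1, 0], [0, -1, 0, 0], [-1, 0, 0, 0]],
     [[0, 0, 1, 0], [0, 0, 0, -1], [-1, 0, 0, 0], [0, 1, 0, 0]],
     [[0, 0, \<i>, 0], [0, 0, 0, \<i>], [\<i>, 0, 0, 0], [0, \<i>, 0, 0]],
     [[0, 0, 0, \<i>], [0, 0, \<i>, 0], [0, \<i>, 0, 0], [\<i>, 0, 0, 0]],
     [[0, 0, \<i>, 0], [0, 0, 0, -\<i>], [\<i>, 0, 0, 0], [0, -\<i>, 0, 0]]]"

text \<open>\<open>J\<^bsup>-1\<^esup> A\<^sup>T J\<close> with \<open>J\<^bsup>-1\<^esup> = -J\<close>.\<close>

definition dual4 :: "complex^4^4 \<Rightarrow> complex^4^4" where
  "dual4 A = - (J4 ** transpose A ** J4)"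

lemma matrix_neg_mult: "(- A) ** B = - (A ** B)" "A ** (- B) = - (A ** B)"
  for A :: "'a::ring_1^'n^'m" and B :: "'a^'p^'n"
  by (simp_all add: vec_eq_iff matrix_matrix_mult_def sum_negf)

lemma dual4_nth:
  "dual4 A = mat4
   [[A$3$3, A$4$3, - A$1$3, - A$2$3],
    [A$3$4, A$4$4, - A$1$4, - A$2$4],
    [- A$3$1, - A$4$1, A$1$1, A$2$1],
    [- A$3$2, - A$4$2, A$1$2, A$2$2]]"
  by (simp add: vec_eq_iff forall_4 dual4_def matrix_matrix_mult_def sum_4 J4_nth transpose_def)

lemma usp4_basis_square: "X \<in> set usp4_basis \<Longrightarrow> X ** X = - mat 1"
proof -
  have "\<forall>X\<in>set usp4_basis. X ** X = - mat 1"
    by (simp add: usp4_basis_def vec_eq_iff forall_4 matrix_matrix_mult_def sum_4 mat_def)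
  then show "X \<in> set usp4_basis \<Longrightarrow> X ** X = - mat 1" by blast
qed

text \<open>The symplectic condition differentiated at the identity. It amounts to
  \<open>dual4 X = - X\<close>; together with the infinitesimal unitarity in
  \<open>usp4_basis_skew\<close> it places \<open>X\<close> in the Lie algebra.\<close>

lemma usp4_basis_J4: "X \<in> set usp4_basis \<Longrightarrow> transpose X ** J4 = - (J4 ** X)"
proof -
  have "\<forall>X\<in>set usp4_basis. transpose X ** J4 = - (J4 ** X)"
    by (simp add: usp4_basis_def vec_eq_iff forall_4 matrix_matrix_mult_def sum_4 J4_nth
      transpose_def)
  then show "X \<in> set usp4_basis \<Longrightarrow> transpose X ** J4 = - (J4 ** X)" by blast
qed
lemma usp4_basis_skew: "X \<in> set usp4_basis \<Longrightarrow> map_matrix cnj X = - transpose X"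
proof -
  have "\<forall>X\<in>set usp4_basis. map_matrix cnj X = - transpose X"
    by (simp add: usp4_basis_def vec_eq_iff forall_4 transpose_def)
  then show "X \<in> set usp4_basis \<Longrightarrow> map_matrix cnj X = - transpose X" by blast
qed

section \<open>Completeness relation of the basis\<close>

text \<open>Up to a factor this is the projection, orthogonal for the trace form, to the complex
  span of the basis, which consists of all \<open>A\<close> with \<open>dual4 A = - A\<close>. The
  projection is \<open>(A - dual4 A) / 2\<close> and the factor is \<open>trace (X ** X)\<close>,
  that is -4.\<close>

lemma sum_usp4_basis_trace:
  "(\<Sum>X\<leftarrow>usp4_basis. mat (trace (X ** A)) ** X) = (dual4 A - A) + (dual4 A - A)"
  by (simp add: usp4_basis_def dual4_nth vec_eq_iff forall_4 matrix_matrix_mult_def sum_4 mat_def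
    trace_def algebra_simps)

text \<open>The same tensor, the sum of all \<open>X $ i $ j * X $ k $ l\<close>, contracted with
  \<open>A\<close> between the two factors instead of through a trace.\<close>

lemma sum_usp4_basis_sandwich:
  "(\<Sum>X\<leftarrow>usp4_basis. X ** A ** X) = - (mat (trace A) + dual4 A) - (mat (trace A) +
    dual4 A)"
  by (simp add: usp4_basis_def dual4_nth vec_eq_iff forall_4 matrix_matrix_mult_def sum_4 mat_def
      trace_def algebra_simps)

text \<open>For self-dual \<open>S\<close> the matrix \<open>J4 ** S\<close> is antisymmetric, so
  the characteristic polynomial of \<open>S\<close> is the square of a quadratic (its root is a
  Pfaffian), and \<open>S\<close> already satisfies the quadratic. Its two roots are the double
  eigenvalues, with sum \<open>trace S / 2\<close> and product \<open>p\<close>.\<close>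

lemma self_dual4_quadratic:
  assumes "dual4 S = S"
  obtains p where "S ** S = mat (trace S / 2) ** S - mat p"
proof -
  have *: "S$3$3 = S$1$1" "S$4$4 = S$2$2" "S$3$4 = S$2$1" "S$4$3 = S$1$2"
     "S$1$3 = 0" "S$2$4 = 0" "S$3$1 = 0" "S$4$2 = 0" "S$2$3 = - S$1$4" "S$4$1 = - S$3$2"
    using arg_cong[OF assms, of "\<lambda>A. A$1$1"] arg_cong[OF assms, of "\<lambda>A. A$2$2"]
      arg_cong[OF assms, of "\<lambda>A. A$3$4"] arg_cong[OF assms, of "\<lambda>A. A$4$3"]
      arg_cong[OF assms, of "\<lambda>A. A$1$3"] arg_cong[OF assms, of "\<lambda>A. A$2$4"]
      arg_cong[OF assms, of "\<lambda>A. A$3$1"] arg_cong[OF assms, of "\<lambda>A. A$4$2"]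
      arg_cong[OF assms, of "\<lambda>A. A$2$3"] arg_cong[OF assms, of "\<lambda>A. A$4$1"]
    by (simp_all add: dual4_nth)
  have tr: "trace S / 2 = S$1$1 + S$2$2"
    by (simp add: trace_def sum_4 *)
  \<comment> \<open>The witness is the determinant of the upper left block plus the contribution of
    the off-diagonal blocks, which are antisymmetric with one free entry each.\<close>
  have "S ** S = mat (trace S / 2) ** S - mat (S$1$1 * S$2$2 - S$1$2 * S$2$1 + S$1$4 * S$3$2)"
    unfolding tr
    by (simp add: vec_eq_iff forall_4 matrix_matrix_mult_def sum_4 mat_def * algebra_simps)
  then show ?thesis by (rule that)
qed

lemma trace_mat_mult: "trace (mat c ** A) = c * trace A" for A :: "'a::comm_ring_1^'n^'n"
  by (simp add: trace_def matrix_matrix_mult_def mat_def sum_distrib_left if_distrib if_distribR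
    cong: if_cong)

lemma matrix_add_rdistrib: "(A + B) ** C = A ** C + B ** C"
  for A B :: "'a::semiring_1^'n^'m" and C :: "'a^'p^'n"
  by (simp add: vec_eq_iff matrix_matrix_mult_def sum.distrib algebra_simps)

lemma sum_list_matrix_mult: "sum_list (map f xs) ** B = (\<Sum>x\<leftarrow>xs. f x ** B)"
  for f :: "'b \<Rightarrow> complex^'n^'n"
  by (induction xs) (simp_all add: matrix_add_rdistrib matrix_matrix_mult_def vec_eq_iff
    sum.distrib algebra_simps)

lemma trace_sum_list: "trace (sum_list (map f xs)) = (\<Sum>x\<leftarrow>xs. trace (f x))"
  for f :: "'b \<Rightarrow> complex^'n^'n"
proof -
  have "trace (0 :: complex^'n^'n) = 0" by (simp add: trace_def)
  then show ?thesis by (induction xs) (simp_all add: trace_add)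
qed

lemma trace_neg: "trace (- A) = - trace A" for A :: "'a::comm_ring_1^'n^'n"
  by (simp add: trace_def sum_negf)

lemma matrix_mult_diff: "(A - B) ** C = A ** C - B ** C" "C ** (A - B) = C ** A - C ** B" for A B
  C :: "complex^'n^'n"
  by (simp_all add: vec_eq_iff matrix_matrix_mult_def sum_subtractf algebra_simps)

text \<open>The scalar \<open>trace (X ** A)\<close> becomes a scalar matrix inside the second
  trace, where the completeness relation applies. With powers of \<open>g\<close> for
  \<open>A\<close> and \<open>B\<close> it computes the products of first derivatives of power
  sums.\<close>

lemma sum_usp4_basis_trace_trace:
  "(\<Sum>X\<leftarrow>usp4_basis. trace (X ** A) * trace (X ** B)) =
     2 * (trace (dual4 A ** B) - trace (A ** B))"
proof -
  have "(\<Sum>X\<leftarrow>usp4_basis. trace (X ** A) * trace (X ** B)) =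
        trace ((\<Sum>X\<leftarrow>usp4_basis. mat (trace (X ** A)) ** X) ** B)"
    by (simp add: sum_list_matrix_mult trace_sum_list trace_mat_mult flip: matrix_mul_assoc)
  also have "\<dots> = 2 * (trace (dual4 A ** B) - trace (A ** B))"
    unfolding sum_usp4_basis_trace
    by (simp only: matrix_add_rdistrib matrix_mult_diff trace_add trace_sub)
      (simp add: algebra_simps)
  finally show ?thesis .
qed

text \<open>Evaluates the mixed term \<open>trace (X ** g ** X ** g)\<close> in the second
  derivative of \<open>trace (g ** g)\<close>.\<close>

lemma sum_usp4_basis_trace_sandwich:
  "(\<Sum>X\<leftarrow>usp4_basis. trace (X ** A ** X ** B)) = - 2 * (trace A * trace B + trace
    (dual4 A ** B))"
proof -
  have "(\<Sum>X\<leftarrow>usp4_basis. trace (X ** A ** X ** B)) =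
        trace ((\<Sum>X\<leftarrow>usp4_basis. X ** A ** X) ** B)"
    by (simp add: sum_list_matrix_mult trace_sum_list)
  also have "\<dots> = - 2 * (trace A * trace B + trace (dual4 A ** B))"
    unfolding sum_usp4_basis_sandwich
    by (simp only: matrix_add_rdistrib matrix_mult_diff matrix_neg_mult trace_add trace_sub
      trace_neg trace_mat_mult)
      (simp add: algebra_simps)
  finally show ?thesis .
qed

section \<open>Inverses in the group and power sums of the eigenvalues\<close>

lemma trace_dual4: "trace (dual4 A) = trace A"
  by (simp add: dual4_nth trace_def sum_4)

text \<open>On the group \<open>dual4\<close> is inversion: multiply the symplectic condition by
  \<open>- J4\<close>, the inverse of \<open>J4\<close>.\<close>

lemma USp4_dual4:
  assumes "g \<in> USp4"
  shows "dual4 g ** g = mat 1" "g ** dual4 g = mat 1"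
proof -
  have "dual4 g ** g = - (J4 ** (transpose g ** J4 ** g))"
    by (simp add: dual4_def matrix_neg_mult matrix_mul_assoc)
  also have "\<dots> = mat 1"
    using assms J4_square by (simp add: USp4_def matrix_neg_mult)
  finally show "dual4 g ** g = mat 1" .
  then show "g ** dual4 g = mat 1"
    using matrix_left_right_inverse by blast
qed

text \<open>The self-dual matrix \<open>g + g\<inverse>\<close> satisfies a quadratic equation, whence the relation between
  the power sums of the eigenvalues.\<close>

lemma trace_USp4_cube:
  assumes "g \<in> USp4"
  shows "2 * trace (g ** g ** g) = 3 * trace g * trace (g ** g) + 6 * trace g - trace g ^ 3"
proof -
  define h where "h = dual4 g"
  define S where "S = g + h"
  have gh: "h ** g = mat 1" "g ** h = mat 1" and th: "trace h = trace g"
    using USp4_dual4[OF assms] trace_dual4[of g] by (auto simp: h_def)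
  have "dual4 S = S"
    by (simp add: S_def h_def dual4_nth vec_eq_iff forall_4)
  then obtain p where p: "S ** S = mat (trace S / 2) ** S - mat p"
    by (rule self_dual4_quadratic)
  have trS: "trace S / 2 = trace g"
    by (simp add: S_def trace_add th)
  have dd: "h ** h = dual4 (g ** g)"
    by (simp add: h_def dual4_nth vec_eq_iff forall_4 matrix_matrix_mult_def sum_4 algebra_simps)
  have SS: "S ** S = g ** g + h ** h + mat 1 + mat 1"
    by (simp add: S_def matrix_add_ldistrib matrix_add_rdistrib gh)
  have thh: "trace (h ** h) = trace (g ** g)"
    by (simp add: dd trace_dual4)
  have tr_mat: "trace (mat c :: complex^4^4) = 4 * c" for c
    by (simp add: trace_def mat_def)
  \<comment> \<open>The trace of the quadratic relation expresses \<open>p\<close> through the first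
    two power sums.\<close>
  have "trace (S ** S) = 2 * trace (g ** g) + 8"
    unfolding SS trace_add thh tr_mat by simp
  moreover have "trace (S ** S) = 2 * trace g ^ 2 - 4 * p"
    unfolding p trS trace_sub trace_mat_mult tr_mat by (simp add: S_def trace_add th
      power2_eq_square)
  ultimately have 1: "2 * trace (g ** g) + 8 = 2 * trace g ^ 2 - 4 * p"
    by simp
  have "h ** h ** g = h"
    by (simp add: gh flip: matrix_mul_assoc)
  \<comment> \<open>Multiplying the quadratic relation by \<open>g\<close> before taking the trace
    brings in the third power sum.\<close>
  then have "trace (S ** S ** g) = trace (g ** g ** g) + 3 * trace g"
    by (simp only: SS matrix_add_rdistrib trace_add th matrix_mul_lid) simp
  moreover have "trace (S ** S ** g) = trace g * (trace (g ** g) + 4) - p * trace g"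
    unfolding p trS
    by (simp add: S_def matrix_add_rdistrib matrix_mult_diff trace_sub trace_mat_mult trace_add
      gh tr_mat
       flip: matrix_mul_assoc)
  ultimately show ?thesis
    using 1 by algebra
qed

section \<open>Differentiating the invariance of the Haar measure\<close>

lemma bounded_bilinear_matrix_mult:
  "bounded_bilinear ((**) :: complex^'n^'n \<Rightarrow> complex^'n^'n \<Rightarrow> complex^'n^'n)"
  by (rule bilinear_conv_bounded_bilinear[THEN iffD1])
    (auto simp: bilinear_def vec_eq_iff matrix_matrix_mult_def sum.distrib scaleR_right.sum
      algebra_simps intro!: linearI)

lemma bounded_linear_trace: "bounded_linear (trace :: complex^'n^'n \<Rightarrow> complex)"
  by (rule linear_conv_bounded_linear[THEN iffD1])
    (auto simp: trace_def sum.distrib scaleR_right.sum intro!: linearI)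

lemmas continuous_on_matrix_mult [continuous_intros] =
  bounded_bilinear.continuous_on[OF bounded_bilinear_matrix_mult]

lemmas continuous_on_trace [continuous_intros] =
  bounded_linear.continuous_on[OF bounded_linear_trace]

text \<open>The closure of a bounded set is compact, and \<open>F\<close> is continuous there
  too.\<close>

lemma continuous_bounded_on_bounded:
  fixes F :: "'a::euclidean_space \<Rightarrow> 'b::real_normed_vector"
  assumes "bounded G" "continuous_on UNIV F"
  obtains B where "\<And>g. g \<in> G \<Longrightarrow> norm (F g) \<le> B"
proof -
  have "compact (F ` closure G)"
    using assms by (intro compact_continuous_image) (auto intro: continuous_on_subset)
  then obtain B where "\<forall>y\<in>F ` closure G. norm y \<le> B"
    using compact_imp_bounded bounded_iff by metis
  then show ?thesis
    using closure_subset[of G] that by blast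
qed

context
  fixes G :: "(complex^'n^'n) set" and M :: "(complex^'n^'n) measure"
  assumes haar: "is_normalized_haar G M"
    and bounded_G: "bounded G"
    and mult_G: "\<And>g h. g \<in> G \<Longrightarrow> h \<in> G \<Longrightarrow> g ** h \<in> G"
begin

lemma prob_space_haar: "prob_space M"
  using haar by (simp add: is_normalized_haar_def)

lemma sets_haar: "sets M = sets (restrict_space borel G)"
  using haar by (simp add: is_normalized_haar_def)

lemma space_haar: "space M = G"
  using sets_eq_imp_space_eq[OF sets_haar] by (simp add: space_restrict_space)

lemma haar_measurable:
  fixes F :: "complex^'n^'n \<Rightarrow> complex"
  assumes "continuous_on UNIV F"
  shows "F \<in> borel_measurable M"
  using borel_measurable_continuous_onI[OF assms]
  by (subst measurable_cong_sets[OF sets_haar refl]) (rule measurable_restrict_space1)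

lemma haar_integrable:
  fixes F :: "complex^'n^'n \<Rightarrow> complex"
  assumes "continuous_on UNIV F"
  shows "integrable M F"
proof -
  interpret prob_space M by (rule prob_space_haar)
  obtain B where "\<And>g. g \<in> G \<Longrightarrow> norm (F g) \<le> B"
    using continuous_bounded_on_bounded[OF bounded_G assms] by metis
  then show ?thesis
    by (intro integrable_const_bound[where B = B] haar_measurable assms) (auto simp: space_haar)
qed

lemma haar_left_invariant:
  fixes F :: "complex^'n^'n \<Rightarrow> complex"
  assumes "g \<in> G" "continuous_on UNIV F"
  shows "(\<integral>m. F (g ** m) \<partial>M) = (\<integral>m. F m \<partial>M)"
proof -
  have "(\<lambda>m :: complex^'n^'n. g ** m) \<in> borel \<rightarrow>\<^sub>M borel"
    by (intro borel_measurable_continuous_onI continuous_intros)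
  \<comment> \<open>Closure of \<open>G\<close> under products makes the translation measurable for
    the restricted sigma-algebra.\<close>
  then have "(\<lambda>m :: complex^'n^'n. g ** m) \<in> restrict_space borel G
    \<rightarrow>\<^sub>M restrict_space borel G"
    using assms(1) mult_G
    by (intro measurable_restrict_space2 measurable_restrict_space1)
      (auto simp: space_restrict_space Pi_iff)
  then have meas: "(\<lambda>m. g ** m) \<in> M \<rightarrow>\<^sub>M M"
    by (subst measurable_cong_sets[OF sets_haar sets_haar])
  have "(\<integral>m. F m \<partial>M) = (\<integral>m. F m \<partial>distr M M (\<lambda>m. g
    ** m))"
    using haar assms by (simp add: is_normalized_haar_def)
  also have "\<dots> = (\<integral>m. F (g ** m) \<partial>M)"
    by (rule integral_distr[OF meas haar_measurable[OF assms(2)]])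
  finally show ?thesis by simp
qed

text \<open>By left invariance the integral of \<open>F (\<gamma> t ** g)\<close> over
  \<open>g\<close> does not depend on \<open>t\<close>; differentiate under the integral at
  \<open>t = 0\<close>. Dominated convergence is applied to the difference quotients
  \<open>D n\<close> at \<open>t = 1 / (n + 1)\<close>.\<close>

lemma haar_integral_derivative:
  fixes F F' :: "complex^'n^'n \<Rightarrow> complex"
  assumes \<gamma>: "\<And>t. \<gamma> t \<in> G" "\<gamma> 0 = mat 1"
    and F: "continuous_on UNIV F" and F': "continuous_on UNIV F'"
    and deriv: "\<And>t g. g \<in> G \<Longrightarrow>
      ((\<lambda>t. F (\<gamma> t ** g)) has_vector_derivative F' (\<gamma> t ** g)) (at t)"
  shows "(\<integral>m. F' m \<partial>M) = 0"
proof -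
  interpret prob_space M by (rule prob_space_haar)
  define D where "D n g = real (Suc n) *\<^sub>R (F (\<gamma> (1 / real (Suc n)) ** g) - F g)"
    for n g
  obtain B where B: "\<And>g. g \<in> G \<Longrightarrow> norm (F' g) \<le> B"
    using continuous_bounded_on_bounded[OF bounded_G F'] by metis
  have contF: "continuous_on UNIV (\<lambda>g. F (h ** g))" for h :: "complex^'n^'n"
    by (intro continuous_on_compose2[OF F] continuous_intros) auto
  have cont: "continuous_on UNIV (D n)" for n
    unfolding D_def by (intro continuous_intros contF F)
  have int0: "(\<integral>m. D n m \<partial>M) = 0" for n
    using haar_left_invariant[OF \<gamma>(1) F, of "1 / real (Suc n)"]
    by (simp add: D_def haar_integrable contF F)
  have lim: "(\<lambda>n. D n g) \<longlonglongrightarrow> F' g" if "g \<in> G" for g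
  proof -
    have "((\<lambda>t. F (\<gamma> t ** g)) has_vector_derivative F' g) (at 0)"
      using deriv[OF that, of 0] \<gamma>(2) by simp
    then have "((\<lambda>t. norm ((1 / norm t) *\<^sub>R (F (\<gamma> t ** g) - (F g + t
      *\<^sub>R F' g)))) \<longlongrightarrow> 0) (at 0)"
      using \<gamma>(2) unfolding has_vector_derivative_def has_derivative_at2
      by (intro tendsto_norm_zero) simp
    \<comment> \<open>The definition of the derivative divides by \<open>norm t\<close>; under the
      outer norm this may be replaced by \<open>t\<close>.\<close>
    moreover have "\<forall>\<^sub>F t in at 0. norm ((1 / norm t) *\<^sub>R (F (\<gamma> t ** g)
      - (F g + t *\<^sub>R F' g))) =
        norm ((1 / t) *\<^sub>R (F (\<gamma> t ** g) - F g) - F' g)"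
    proof (rule eventually_mono[OF eventually_neq_at_within])
      fix t :: real assume t: "t \<noteq> 0"
      then have "(1 / t) *\<^sub>R (F (\<gamma> t ** g) - F g) - F' g = (1 / t) *\<^sub>R (F
        (\<gamma> t ** g) - (F g + t *\<^sub>R F' g))"
        by (simp add: scaleR_diff_right scaleR_add_right)
      then show "norm ((1 / norm t) *\<^sub>R (F (\<gamma> t ** g) - (F g + t *\<^sub>R F' g))) =
        norm ((1 / t) *\<^sub>R (F (\<gamma> t ** g) - F g) - F' g)"
        by simp
    qed
    ultimately have "((\<lambda>t. norm ((1 / t) *\<^sub>R (F (\<gamma> t ** g) - F g) - F' g))
      \<longlongrightarrow> 0) (at 0)"
      by (rule Lim_transform_eventually)
    then have "((\<lambda>t. (1 / t) *\<^sub>R (F (\<gamma> t ** g) - F g)) \<longlongrightarrow>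
      F' g) (at 0)"
      by (rule LIM_zero_cancel[OF tendsto_norm_zero_cancel])
    moreover have "filterlim (\<lambda>n. 1 / real (Suc n)) (at 0) sequentially"
      using LIMSEQ_Suc[OF lim_1_over_n[where 'a = real]] by (auto simp: filterlim_at)
    ultimately show ?thesis
      unfolding D_def by (rule filterlim_compose[THEN tendsto_cong[THEN iffD1, rotated]]) simp
  qed
  have bound: "norm (D n g) \<le> B" if g: "g \<in> G" for n g
  proof -
    \<comment> \<open>Mean value inequality: the derivative at time \<open>t\<close> is
      \<open>F'\<close> at the point \<open>\<gamma> t ** g\<close> of \<open>G\<close>, so the
      single bound \<open>B\<close> serves for all \<open>t\<close>.\<close>
    have "norm (F (\<gamma> (1 / real (Suc n)) ** g) - F (\<gamma> 0 ** g)) \<le> B * norm (1 /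
      real (Suc n) - 0)"
    proof (rule differentiable_bound[where S = UNIV and f = "\<lambda>t. F (\<gamma> t ** g)"])
      show "((\<lambda>t. F (\<gamma> t ** g)) has_derivative (\<lambda>h. h *\<^sub>R F'
        (\<gamma> t ** g))) (at t within UNIV)" for t
        using deriv[OF g, of t] by (simp add: has_vector_derivative_def)
      show "onorm (\<lambda>h. h *\<^sub>R F' (\<gamma> t ** g)) \<le> B" for t
        using B[OF mult_G[OF \<gamma>(1) g, of t]]
        by (intro onorm_le) (simp add: mult.commute[of B] mult_left_mono)
    qed auto
    then show ?thesis
      by (simp add: D_def \<gamma>(2) pos_le_divide_eq mult.commute del: of_nat_Suc)
  qed
  have "(\<lambda>n. \<integral>m. D n m \<partial>M) \<longlonglongrightarrow> (\<integral>m. F'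
    m \<partial>M)"
    using lim bound
    by (intro integral_dominated_convergence[where w = "\<lambda>_. B"] haar_measurable cont F')
      (auto simp: space_haar)
  then show ?thesis
    by (simp add: int0 LIMSEQ_const_iff)
qed

end

section \<open>The moments of the trace\<close>

lemma USp4_mult:
  assumes "g \<in> USp4" "h \<in> USp4"
  shows "g ** h \<in> USp4"
proof -
  have "transpose (g ** h) ** J4 ** (g ** h) = transpose h ** (transpose g ** J4 ** g) ** h"
    by (simp add: matrix_transpose_mul matrix_mul_assoc)
  then have 1: "transpose (g ** h) ** J4 ** (g ** h) = J4"
    using assms by (simp add: USp4_def)
  have "map_matrix cnj (g ** h) = map_matrix cnj g ** map_matrix cnj h"
    by (simp add: vec_eq_iff matrix_matrix_mult_def)
  then have "transpose (g ** h) ** map_matrix cnj (g ** h) =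
      transpose h ** (transpose g ** map_matrix cnj g) ** map_matrix cnj h"
    by (simp add: matrix_transpose_mul matrix_mul_assoc)
  then have 2: "transpose (g ** h) ** map_matrix cnj (g ** h) = mat 1"
    using assms by (simp add: USp4_def)
  show ?thesis
    using assms 1 2 by (simp add: USp4_def invertible_mult)
qed

text \<open>The four columns are unit vectors, so the norm is in fact 2.\<close>

lemma bounded_USp4: "bounded USp4"
proof -
  have "norm m \<le> 4" if "m \<in> USp4" for m
  proof -
    have U: "transpose m ** map_matrix cnj m = mat 1"
      using that by (auto simp: USp4_def)
    have "(\<Sum>k\<in>UNIV. (norm (m $ k $ i))\<^sup>2) = 1" for i
    proof -
      have "(\<Sum>k\<in>UNIV. m $ k $ i * cnj (m $ k $ i)) = 1"
        using arg_cong[OF U, of "\<lambda>A. A $ i $ i"]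
        by (simp add: matrix_matrix_mult_def transpose_def mat_def)
      then have "complex_of_real (\<Sum>k\<in>UNIV. (norm (m $ k $ i))\<^sup>2) = complex_of_real 1"
        by (simp del: of_real_power add: complex_norm_square)
      then show ?thesis
        by (simp only: of_real_eq_iff)
    qed
    then have "(\<Sum>i\<in>UNIV. \<Sum>k\<in>UNIV. (norm (m $ k $ i))\<^sup>2) = 4"
      by simp
    then have "(norm m)\<^sup>2 = 4"
      by (subst (asm) sum.swap) (simp add: norm_vec_def L2_set_def sum_nonneg)
    then show ?thesis
      by (simp add: power2_le_imp_le)
  qed
  then show ?thesis
    by (auto simp: bounded_iff)
qed

definition rotation :: "complex^'n^'n \<Rightarrow> real \<Rightarrow> complex^'n^'n" where
  "rotation X t = cos t *\<^sub>R mat 1 + sin t *\<^sub>R X"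

lemma scaleR_matrix_mult:
  "(c *\<^sub>R A) ** B = c *\<^sub>R (A ** B)" "A ** (c *\<^sub>R B) = c *\<^sub>R (A ** B)"
  for A B :: "complex^'n^'n"
  by (simp_all add: vec_eq_iff matrix_matrix_mult_def scaleR_right.sum)

lemma rotation_has_vector_derivative:
  fixes X g :: "complex^'n^'n"
  assumes "X ** X = - mat 1"
  shows "((\<lambda>t. rotation X t ** g) has_vector_derivative X ** (rotation X t ** g)) (at t)"
proof -
  have "((\<lambda>t. cos t *\<^sub>R g + sin t *\<^sub>R (X ** g)) has_vector_derivative
      - sin t *\<^sub>R g + cos t *\<^sub>R (X ** g)) (at t)"
    by (auto intro!: derivative_eq_intros simp:
      has_real_derivative_iff_has_vector_derivative[symmetric])
  moreover have "X ** (rotation X t ** g) = - sin t *\<^sub>R g + cos t *\<^sub>R (X ** g)"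
    by (simp add: rotation_def matrix_add_rdistrib matrix_add_ldistrib scaleR_matrix_mult
      matrix_mul_assoc assms matrix_neg_mult)
  moreover have "rotation X t ** g = cos t *\<^sub>R g + sin t *\<^sub>R (X ** g)" for t
    by (simp add: rotation_def matrix_add_rdistrib scaleR_matrix_mult)
  ultimately show ?thesis by simp
qed

text \<open>In \<open>transpose g ** J4 ** g\<close> the mixed terms cancel by
  \<open>usp4_basis_J4\<close>, and \<open>X ** X = - mat 1\<close> turns the rest into
  \<open>(cos t)\<^sup>2 + (sin t)\<^sup>2\<close> times \<open>J4\<close>. The unitarity condition
  is treated in the same way.\<close>

lemma rotation_in_USp4:
  assumes X: "X \<in> set usp4_basis"
  shows "rotation X t \<in> USp4"
proof -
  note sq = usp4_basis_square[OF X] and J = usp4_basis_J4[OF X] and sk = usp4_basis_skew[OF X]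
  have tr: "transpose (rotation X t) = cos t *\<^sub>R mat 1 + sin t *\<^sub>R transpose X"
    by (simp add: rotation_def vec_eq_iff transpose_def mat_def)
  have cn: "map_matrix cnj (rotation X t) = cos t *\<^sub>R mat 1 - sin t *\<^sub>R transpose X"
    using sk by (simp add: rotation_def vec_eq_iff mat_def)
  have sc: "sin t *\<^sub>R sin t *\<^sub>R A + cos t *\<^sub>R cos t *\<^sub>R A = A" for A ::
    "complex^4^4"
    by (simp flip: scaleR_add_left power2_eq_square)
  have sqT: "transpose X ** transpose X = - mat 1"
  proof -
    have "transpose X ** transpose X = transpose (- mat 1)"
      by (simp add: sq flip: matrix_transpose_mul)
    then show ?thesis by (simp add: transpose_def mat_def vec_eq_iff)
  qed
  have XJX: "J4 ** X ** X = - J4"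
    using sq by (simp add: matrix_neg_mult flip: matrix_mul_assoc)
  have 1: "transpose (rotation X t) ** J4 ** rotation X t = J4"
    using sc[of J4] unfolding tr unfolding rotation_def
    by (simp add: matrix_add_rdistrib matrix_add_ldistrib matrix_mult_diff scaleR_matrix_mult J
      matrix_neg_mult XJX algebra_simps)
  have 2: "transpose (rotation X t) ** map_matrix cnj (rotation X t) = mat 1"
    using sc[of "mat 1"] unfolding tr cn
    by (simp add: matrix_add_rdistrib matrix_mult_diff scaleR_matrix_mult sqT algebra_simps)
  have "transpose (map_matrix cnj (rotation X t)) ** rotation X t = mat 1"
    using arg_cong[OF 2, of transpose] by (simp add: matrix_transpose_mul)
  then have "invertible (rotation X t)"
    using invertible_left_inverse by blast
  then show ?thesis
    using 1 2 by (simp add: USp4_def)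
qed

lemma has_vector_derivative_trace:
  fixes h' :: "complex^'n^'n"
  assumes "(h has_vector_derivative h') F"
  shows "((\<lambda>t. trace (h t)) has_vector_derivative trace h') F"
  using bounded_linear.has_vector_derivative[OF bounded_linear_trace assms] .

lemma has_vector_derivative_matrix_mult:
  fixes f g :: "real \<Rightarrow> complex^'n^'n"
  assumes "(f has_vector_derivative f') (at t within S)" "(g has_vector_derivative g') (at t
    within S)"
  shows "((\<lambda>t. f t ** g t) has_vector_derivative (f t ** g' + f' ** g t)) (at t within S)"
  using bounded_bilinear.has_vector_derivative[OF bounded_bilinear_matrix_mult assms] .

text \<open>For \<open>n = 0\<close> the truncated exponent \<open>n - 1\<close> does no harm, since
  the factor \<open>of_nat n\<close> vanishes. The same convention is used in the moment equations
  below.\<close>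

lemma has_vector_derivative_power:
  fixes f :: "real \<Rightarrow> complex"
  assumes "(f has_vector_derivative f') (at t within S)"
  shows "((\<lambda>t. f t ^ n) has_vector_derivative of_nat n * f t ^ (n - 1) * f') (at t within
    S)"
proof (induction n)
  case (Suc n)
  have "((\<lambda>t. f t * f t ^ n) has_vector_derivative f t * (of_nat n * f t ^ (n - 1) * f')
    + f' * f t ^ n) (at t within S)"
    by (rule has_vector_derivative_mult[OF assms Suc])
  then show ?case
    by (cases n) (simp_all add: algebra_simps)
qed simp

section \<open>Moment equations from the invariance of the Haar measure\<close>

context
  fixes M :: "(complex^4^4) measure"
  assumes haar: "is_normalized_haar USp4 M"
begin

lemmas USp4_integrable = haar_integrable[OF haar bounded_USp4 USp4_mult]

text \<open>\<open>Q'\<close> is the derivative of \<open>Q\<close> in the direction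
  \<open>X ** g\<close> at \<open>g\<close>. Phrasing it through arbitrary curves with velocity
  \<open>X ** h t\<close> lets each instance be checked by the product rule alone.\<close>

lemma USp4_trace_derivative:
  assumes X: "X \<in> set usp4_basis"
    and Q: "continuous_on UNIV Q" "continuous_on UNIV Q'"
      "\<And>h t. (h has_vector_derivative X ** h t) (at t) \<Longrightarrow>
        ((\<lambda>t. Q (h t)) has_vector_derivative Q' (h t)) (at t)"
  shows "(\<integral>g. Q' g * trace g ^ n + of_nat n * trace g ^ (n - 1) * trace (X ** g) * Q g
    \<partial>M) = 0"
proof (rule haar_integral_derivative[OF haar bounded_USp4 USp4_mult, where \<gamma> = "rotation
  X" and F = "\<lambda>g. Q g * trace g ^ n"])
  show "rotation X t \<in> USp4" for t
    by (rule rotation_in_USp4[OF X])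
  show "rotation X 0 = mat 1"
    by (simp add: rotation_def)
  show "continuous_on UNIV (\<lambda>g. Q g * trace g ^ n)"
     "continuous_on UNIV (\<lambda>g. Q' g * trace g ^ n + of_nat n * trace g ^ (n - 1) * trace
       (X ** g) * Q g)"
    by (intro continuous_intros Q)+
  fix t and g :: "complex^4^4"
  have d: "((\<lambda>t. rotation X t ** g) has_vector_derivative X ** (rotation X t ** g)) (at t)"
    by (rule rotation_has_vector_derivative[OF usp4_basis_square[OF X]])
  from has_vector_derivative_mult[OF Q(3)[OF d] has_vector_derivative_power[OF
    has_vector_derivative_trace[OF d], of n]]
  show "((\<lambda>t. Q (rotation X t ** g) * trace (rotation X t ** g) ^ n) has_vector_derivative
     Q' (rotation X t ** g) * trace (rotation X t ** g) ^ n + of_nat n * trace (rotation X t **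
       g) ^ (n - 1)
      * trace (X ** (rotation X t ** g)) * Q (rotation X t ** g)) (at t)"
    by (simp add: algebra_simps)
qed

lemma integral_sum_list:
  fixes f :: "'b \<Rightarrow> 'c \<Rightarrow> complex"
  assumes "\<And>x. x \<in> set xs \<Longrightarrow> integrable N (f x)"
  shows "(\<integral>g. (\<Sum>x\<leftarrow>xs. f x g) \<partial>N) = (\<Sum>x\<leftarrow>xs.
    \<integral>g. f x g \<partial>N)"
proof -
  have "integrable N (\<lambda>g. \<Sum>x\<leftarrow>xs. f x g) \<and>
      (\<integral>g. (\<Sum>x\<leftarrow>xs. f x g) \<partial>N) = (\<Sum>x\<leftarrow>xs.
        \<integral>g. f x g \<partial>N)"
    using assms by (induction xs) auto
  then show ?thesis ..
qed

text \<open>The sum over the basis is moved inside the integral, where the completeness relation can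
  evaluate it pointwise. \<open>Q\<close> may depend on \<open>X\<close>, as a first derivative
  along \<open>X\<close> does.\<close>

lemma USp4_trace_derivative_sum:
  assumes Q: "\<And>X. X \<in> set usp4_basis \<Longrightarrow> continuous_on UNIV (Q X)"
      "\<And>X. X \<in> set usp4_basis \<Longrightarrow> continuous_on UNIV (Q' X)"
      "\<And>X h t. X \<in> set usp4_basis \<Longrightarrow> (h has_vector_derivative X ** h t)
        (at t) \<Longrightarrow>
        ((\<lambda>t. Q X (h t)) has_vector_derivative Q' X (h t)) (at t)"
  shows "(\<integral>g. (\<Sum>X\<leftarrow>usp4_basis. Q' X g) * trace g ^ n
      + of_nat n * trace g ^ (n - 1) * (\<Sum>X\<leftarrow>usp4_basis. trace (X ** g) * Q X g)
        \<partial>M) = 0"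
proof -
  let ?f = "\<lambda>X g. Q' X g * trace g ^ n + of_nat n * trace g ^ (n - 1) * trace (X ** g) *
    Q X g"
  have int: "integrable M (?f X)" if "X \<in> set usp4_basis" for X
    by (intro USp4_integrable continuous_intros Q that)
  have "(\<Sum>X\<leftarrow>usp4_basis. Q' X g) * trace g ^ n
      + of_nat n * trace g ^ (n - 1) * (\<Sum>X\<leftarrow>usp4_basis. trace (X ** g) * Q X g) =
      (\<Sum>X\<leftarrow>usp4_basis. ?f X g)" for g
    by (simp add: sum_list_addf sum_list_mult_const sum_list_const_mult mult.assoc)
  then have "(\<integral>g. (\<Sum>X\<leftarrow>usp4_basis. Q' X g) * trace g ^ n
      + of_nat n * trace g ^ (n - 1) * (\<Sum>X\<leftarrow>usp4_basis. trace (X ** g) * Q X g)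
        \<partial>M) =
      (\<integral>g. (\<Sum>X\<leftarrow>usp4_basis. ?f X g) \<partial>M)"
    by simp
  also have "\<dots> = (\<Sum>X\<leftarrow>usp4_basis. \<integral>g. ?f X g \<partial>M)"
    by (rule integral_sum_list[OF int])
  also have "\<dots> = (\<Sum>X\<leftarrow>usp4_basis. 0)"
    by (intro arg_cong[where f = sum_list] map_cong refl USp4_trace_derivative Q)
  finally show ?thesis by simp
qed

lemma length_usp4_basis: "length usp4_basis = 10"
  by (simp add: usp4_basis_def)

lemma sum_usp4_basis_const: "(\<Sum>X\<leftarrow>usp4_basis. c) = 10 * c" for c :: complex
  by (simp add: sum_list_triv length_usp4_basis)

lemma trace_usp4_basis_square:
  assumes "X \<in> set usp4_basis"
  shows "trace (X ** (X ** A)) = - trace A"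
  by (simp add: matrix_mul_assoc usp4_basis_square[OF assms] matrix_neg_mult trace_neg)

text \<open>Here \<open>Q\<close> is \<open>trace (X ** g)\<close>. The 10 is the dimension of the
  Lie algebra, each \<open>X\<close> contributing \<open>- trace g\<close>; the term
  \<open>8 - 2 * trace (g ** g)\<close> is the contraction of two first derivatives, with
  \<open>trace (dual4 g ** g) = 4\<close>.\<close>

lemma USp4_moment_equation_trace:
  "(\<integral>g. - 10 * trace g ^ Suc n + of_nat n * trace g ^ (n - 1) * (8 - 2 * trace (g **
    g)) \<partial>M) = 0"
proof -
  have *: "(\<Sum>X\<leftarrow>usp4_basis. trace (X ** (X ** g))) = - 10 * trace g" for g
  proof -
    have "(\<Sum>X\<leftarrow>usp4_basis. trace (X ** (X ** g))) =
      (\<Sum>X\<leftarrow>usp4_basis. - trace g)"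
      by (intro arg_cong[where f = sum_list] map_cong refl trace_usp4_basis_square)
    then show ?thesis by (simp add: sum_usp4_basis_const)
  qed
  have "(\<integral>g. (\<Sum>X\<leftarrow>usp4_basis. trace (X ** (X ** g))) * trace g ^ n
      + of_nat n * trace g ^ (n - 1) * (\<Sum>X\<leftarrow>usp4_basis. trace (X ** g) * trace (X
        ** g)) \<partial>M) = 0"
  proof (rule USp4_trace_derivative_sum)
    fix X :: "complex^4^4" and h :: "real \<Rightarrow> complex^4^4" and t assume "(h
      has_vector_derivative X ** h t) (at t)"
    then show "((\<lambda>t. trace (X ** h t)) has_vector_derivative trace (X ** (X ** h t))) (at
      t)"
      using has_vector_derivative_trace[OF has_vector_derivative_matrix_mult[OF
        has_vector_derivative_const]]
      by fastforce
  qed (intro continuous_intros)+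
  also have "(\<integral>g. (\<Sum>X\<leftarrow>usp4_basis. trace (X ** (X ** g))) * trace g ^ n
      + of_nat n * trace g ^ (n - 1) * (\<Sum>X\<leftarrow>usp4_basis. trace (X ** g) * trace (X
        ** g)) \<partial>M) =
    (\<integral>g. - 10 * trace g ^ Suc n + of_nat n * trace g ^ (n - 1) * (8 - 2 * trace (g **
      g)) \<partial>M)"
    unfolding * sum_usp4_basis_trace_trace
    by (intro Bochner_Integration.integral_cong refl)
      (simp add: space_haar[OF haar bounded_USp4 USp4_mult] USp4_dual4 trace_I)
  finally show ?thesis .
qed

text \<open>Here \<open>Q\<close> is \<open>trace (X ** (g ** g))\<close>. Its contraction with
  \<open>trace (X ** g)\<close> produces the third power sum, which \<open>trace_USp4_cube\<close>
  removes.\<close>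

lemma USp4_moment_equation_trace_square:
  "(\<integral>g. (- 2 * trace g ^ 2 - 8 - 10 * trace (g ** g)) * trace g ^ n
      + of_nat n * trace g ^ (n - 1) * (trace g ^ 3 - 3 * trace g * trace (g ** g) - 4 * trace g)
        \<partial>M) = 0"
proof -
  let ?Q' = "\<lambda>X g. trace (X ** g ** X ** g) + trace (X ** (X ** (g ** g)))"
  have *: "(\<Sum>X\<leftarrow>usp4_basis. ?Q' X g) = - 2 * (trace g * trace g + trace (dual4 g
    ** g)) - 10 * trace (g ** g)" for g
  proof -
    have "(\<Sum>X\<leftarrow>usp4_basis. ?Q' X g) = (\<Sum>X\<leftarrow>usp4_basis. trace (X **
      g ** X ** g)) + (\<Sum>X\<leftarrow>usp4_basis. - trace (g ** g))"
      unfolding sum_list_addf[symmetric]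
      by (intro arg_cong[where f = sum_list] map_cong refl arg_cong2[where f = "(+)"]
        trace_usp4_basis_square)
    then show ?thesis by (simp add: sum_usp4_basis_const sum_usp4_basis_trace_sandwich)
  qed
  have "(\<integral>g. (\<Sum>X\<leftarrow>usp4_basis. ?Q' X g) * trace g ^ n
      + of_nat n * trace g ^ (n - 1) * (\<Sum>X\<leftarrow>usp4_basis. trace (X ** g) * trace (X
        ** (g ** g))) \<partial>M) = 0"
  proof (rule USp4_trace_derivative_sum)
    fix X :: "complex^4^4" and h :: "real \<Rightarrow> complex^4^4" and t assume h: "(h
      has_vector_derivative X ** h t) (at t)"
    from has_vector_derivative_trace[OF has_vector_derivative_matrix_mult[OF
      has_vector_derivative_const
        has_vector_derivative_matrix_mult[OF h h]], of X]
    show "((\<lambda>t. trace (X ** (h t ** h t))) has_vector_derivative ?Q' X (h t)) (at t)"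
      by (simp add: matrix_add_ldistrib trace_add matrix_mul_assoc)
  qed (intro continuous_intros)+
  also have "(\<integral>g. (\<Sum>X\<leftarrow>usp4_basis. ?Q' X g) * trace g ^ n
      + of_nat n * trace g ^ (n - 1) * (\<Sum>X\<leftarrow>usp4_basis. trace (X ** g) * trace (X
        ** (g ** g))) \<partial>M) =
    (\<integral>g. (- 2 * trace g ^ 2 - 8 - 10 * trace (g ** g)) * trace g ^ n
      + of_nat n * trace g ^ (n - 1) * (trace g ^ 3 - 3 * trace g * trace (g ** g) - 4 * trace g)
        \<partial>M)"
  proof (intro Bochner_Integration.integral_cong refl)
    fix g assume "g \<in> space M"
    then have g: "g \<in> USp4"
      by (simp add: space_haar[OF haar bounded_USp4 USp4_mult])
    have 1: "2 * (trace (dual4 g ** (g ** g)) - trace (g ** (g ** g))) =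
        trace g ^ 3 - 3 * trace g * trace (g ** g) - 4 * trace g"
      using trace_USp4_cube[OF g] by (simp add: matrix_mul_assoc USp4_dual4[OF g])
    have 2: "trace (dual4 g ** g) = 4"
      by (simp add: USp4_dual4[OF g] trace_I)
    show "(\<Sum>X\<leftarrow>usp4_basis. ?Q' X g) * trace g ^ n
      + of_nat n * trace g ^ (n - 1) * (\<Sum>X\<leftarrow>usp4_basis. trace (X ** g) * trace (X
        ** (g ** g))) =
     (- 2 * trace g ^ 2 - 8 - 10 * trace (g ** g)) * trace g ^ n
      + of_nat n * trace g ^ (n - 1) * (trace g ^ 3 - 3 * trace g * trace (g ** g) - 4 * trace g)"
      unfolding * sum_usp4_basis_trace_trace 1 2 by (simp add: power2_eq_square algebra_simps)
  qed
  finally show ?thesis .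
qed

lemma USp4_trace_moments:
  defines "\<mu> \<equiv> (\<lambda>n. \<integral>g. trace g ^ n \<partial>M)"
  shows "\<mu> 0 = 1" "\<mu> 1 = 0"
    "of_nat ((n + 6) * (n + 8)) * \<mu> (n + 2) = of_nat (16 * (n + 1) * (n + 3)) * \<mu> n"
proof -
  interpret prob_space M
    using haar by (simp add: is_normalized_haar_def)
  show "\<mu> 0 = 1"
    by (simp add: \<mu>_def prob_space)
  \<comment> \<open>At \<open>n = 0\<close> only the term \<open>- 10 * trace g\<close>
    survives.\<close>
  show "\<mu> 1 = 0"
    using USp4_moment_equation_trace[of 0] by (simp add: \<mu>_def)
  define \<nu> where "\<nu> = (\<integral>g. trace g ^ n * trace (g ** g) \<partial>M)"
  have int1: "integrable M (\<lambda>g. trace g ^ k)" for k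
    by (intro USp4_integrable continuous_intros)
  have int2: "integrable M (\<lambda>g. trace g ^ n * trace (g ** g))"
    by (intro USp4_integrable continuous_intros)
  have lin: "(\<integral>g. a * trace g ^ (n + 2) + b * trace g ^ n + c * (trace g ^ n * trace (g
    ** g)) \<partial>M) =
     a * \<mu> (n + 2) + b * \<mu> n + c * \<nu>" for a b c
    unfolding \<mu>_def \<nu>_def using int1[of "n + 2"] int1[of n] int2 by (simp del:
      add_2_eq_Suc')
  \<comment> \<open>The first equation is taken at \<open>Suc n\<close> and the second at
    \<open>n\<close>, so that both involve the same three integrals.\<close>
  have "- 10 * x ^ Suc (Suc n) + of_nat (Suc n) * x ^ (Suc n - 1) * (8 - 2 * y) =
      - 10 * x ^ (n + 2) + 8 * of_nat (Suc n) * x ^ n + (- 2 * of_nat (Suc n)) * (x ^ n * y)" for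
        x y :: complex
    by (simp add: algebra_simps)
  with USp4_moment_equation_trace[of "Suc n"]
  have 1: "- 10 * \<mu> (n + 2) + 8 * of_nat (Suc n) * \<mu> n + (- 2 * of_nat (Suc n)) * \<nu> = 0"
    by (simp only: lin)
  have "(- 2 * x ^ 2 - 8 - 10 * y) * x ^ n + of_nat n * x ^ (n - 1) * (x ^ 3 - 3 * x * y - 4 * x) =
     (of_nat n - 2) * x ^ (n + 2) + (- 8 - 4 * of_nat n) * x ^ n + (- 10 - 3 * of_nat n) * (x ^ n
       * y)" for x y :: complex
    by (cases n) (simp_all add: algebra_simps power2_eq_square power3_eq_cube)
  with USp4_moment_equation_trace_square[of n]
  have 2: "(of_nat n - 2) * \<mu> (n + 2) + (- 8 - 4 * of_nat n) * \<mu> n + (- 10 - 3 * of_nat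
    n) * \<nu> = 0"
    by (simp only: lin)
  \<comment> \<open>\<open>10 + 3 n\<close> times the first equation minus \<open>2 (n + 1)\<close>
    times the second eliminates \<open>\<nu>\<close>. The prefactor is nonzero and cancels.\<close>
  have "2 * of_nat (Suc n) * (of_nat ((n + 6) * (n + 8)) * \<mu> (n + 2) - of_nat (16 * (n + 1) *
    (n + 3)) * \<mu> n) = 0"
    using 1 2 unfolding of_nat_Suc of_nat_mult of_nat_add of_nat_numeral of_nat_1 by algebra
  then show "of_nat ((n + 6) * (n + 8)) * \<mu> (n + 2) = of_nat (16 * (n + 1) * (n + 3)) * \<mu> n"
    by (simp del: of_nat_Suc of_nat_mult)
qed

lemma USp4_tau_moments:
  defines "\<mu> \<equiv> (\<lambda>n. \<integral>g. tau g ^ n \<partial>M)"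
  shows "\<mu> 0 = 1" "\<mu> 1 = 0"
    "real ((n + 6) * (n + 8)) * \<mu> (n + 2) = real (16 * (n + 1) * (n + 3)) * \<mu> n"
proof -
  have eq: "(\<integral>g. trace g ^ k \<partial>M) = of_real (\<mu> k)" for k
  proof -
    have "(\<integral>g. trace g ^ k \<partial>M) = (\<integral>g. of_real (tau g ^ k) \<partial>M)"
    proof (intro Bochner_Integration.integral_cong refl)
      fix g assume "g \<in> space M"
      then have "g \<in> USp4"
        by (simp add: space_haar[OF haar bounded_USp4 USp4_mult])
      then show "trace g ^ k = of_real (tau g ^ k)"
        using trace_USp4_real[of g] by (simp add: tau_def)
    qed
    then show ?thesis
      by (simp only: \<mu>_def integral_complex_of_real)
  qed
  note m = USp4_trace_moments[unfolded eq]
  show "\<mu> 0 = 1" "\<mu> 1 = 0"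
    using m(1,2) by (simp_all only: of_real_eq_1_iff of_real_eq_0_iff)
  have "complex_of_real (real ((n + 6) * (n + 8)) * \<mu> (n + 2)) = complex_of_real (real (16 *
    (n + 1) * (n + 3)) * \<mu> n)"
    using m(3)[of n] by (simp only: of_real_mult of_real_of_nat_eq)
  then show "real ((n + 6) * (n + 8)) * \<mu> (n + 2) = real (16 * (n + 1) * (n + 3)) * \<mu> n"
    by (simp only: of_real_eq_iff)
qed

end

section \<open>Complete elliptic integrals in the complementary modulus\<close>

text \<open>The parameter is \<open>1 - y\<^sup>2\<close> with \<open>y\<close> the complementary
  modulus. In the theorem \<open>y\<close> is \<open>\<bar>x\<bar> / 4\<close>, so moments in
  \<open>x\<close> become moments in \<open>y\<close>.\<close>

definition radicand :: "real \<Rightarrow> real \<Rightarrow> real" where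
  "radicand y t = 1 - (1 - y\<^sup>2) * (sin t)\<^sup>2"

definition compl_E :: "real \<Rightarrow> real" where
  "compl_E y = ellipticE (1 - y\<^sup>2)"

definition compl_K :: "real \<Rightarrow> real" where
  "compl_K y = ellipticK (1 - y\<^sup>2)"

lemma compl_E_eq: "compl_E y = integral {0..pi/2} (\<lambda>t. sqrt (radicand y t))"
  by (simp add: compl_E_def ellipticE_def radicand_def)

lemma compl_K_eq: "compl_K y = integral {0..pi/2} (\<lambda>t. 1 / sqrt (radicand y t))"
  by (simp add: compl_K_def ellipticK_def radicand_def)

lemma radicand_eq: "radicand y t = (cos t)\<^sup>2 + y\<^sup>2 * (sin t)\<^sup>2"
  by (simp add: radicand_def cos_squared_eq algebra_simps)

lemma radicand_pos: "radicand y t > 0" if "y > 0"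
proof (cases "sin t = 0")
  case False
  then show ?thesis using that by (simp add: radicand_eq add_nonneg_pos)
qed (simp add: radicand_def)

lemma radicand_bounds: "y\<^sup>2 \<le> radicand y t" "radicand y t \<le> 1" if "0 \<le> y" "y
  \<le> 1"
proof -
  have *: "(sin t)\<^sup>2 \<le> 1" "0 \<le> 1 - y\<^sup>2"
    using that by (simp_all add: abs_square_le_1 power_le_one)
  then have "(1 - y\<^sup>2) * (sin t)\<^sup>2 \<le> (1 - y\<^sup>2) * 1"
    by (intro mult_left_mono)
  then show "y\<^sup>2 \<le> radicand y t" by (simp add: radicand_def)
  show "radicand y t \<le> 1" using * by (simp add: radicand_def)
qed

lemma continuous_on_radicand [continuous_intros]:
  fixes f g :: "'a::t2_space \<Rightarrow> real"
  assumes "continuous_on S f" "continuous_on S g"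
  shows "continuous_on S (\<lambda>x. radicand (f x) (g x))"
  unfolding radicand_def by (intro continuous_intros assms)

lemma DERIV_radicand_fst: "((\<lambda>y. radicand y t) has_real_derivative 2 * y * (sin
  t)\<^sup>2) (at y within S)"
  unfolding radicand_def by (auto intro!: derivative_eq_intros)

lemma DERIV_radicand_snd:
  "(radicand y has_real_derivative - 2 * (1 - y\<^sup>2) * sin t * cos t) (at t within S)"
  unfolding radicand_def[abs_def] by (auto intro!: derivative_eq_intros simp: algebra_simps)

lemma sqrt_radicand_integrable: "(\<lambda>t. sqrt (radicand y t)) integrable_on {a..b}"
  by (intro integrable_continuous_interval continuous_intros)

lemma inverse_sqrt_radicand_integrable:
  "(\<lambda>t. 1 / sqrt (radicand y t)) integrable_on {a..b}" if "y > 0"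
  using radicand_pos[OF that]
  by (intro integrable_continuous_interval continuous_intros) (auto simp: less_imp_neq[symmetric])

text \<open>Leibniz rule on the open half-line, where the radicand is positive; at
  \<open>y = 0\<close> it vanishes for \<open>t = pi/2\<close>.\<close>

lemma compl_E_DERIV:
  assumes y: "y > 0"
  shows "(compl_E has_real_derivative
    integral {0..pi/2} (\<lambda>t. y * (sin t)\<^sup>2 / sqrt (radicand y t))) (at y)"
proof -
  have "((\<lambda>y. integral (cbox 0 (pi/2)) (\<lambda>t. sqrt (radicand y t)))
    has_real_derivative
      integral (cbox 0 (pi/2)) (\<lambda>t. y * (sin t)\<^sup>2 / sqrt (radicand y t))) (at y
        within {0<..})"
  proof (rule leibniz_rule_field_derivative)
    fix x t :: real assume "x \<in> {0<..}"
    then show "((\<lambda>y. sqrt (radicand y t)) has_real_derivative x * (sin t)\<^sup>2 / sqrt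
      (radicand x t)) (at x within {0<..})"
      using radicand_pos[of x t]
      by (auto intro!: derivative_eq_intros DERIV_radicand_fst simp: field_simps)
  next
    show "continuous_on ({0<..} \<times> cbox 0 (pi / 2)) (\<lambda>(x, t). x * (sin t)\<^sup>2 /
      sqrt (radicand x t))"
      using radicand_pos unfolding split_beta
      by (intro continuous_intros) (auto simp: less_imp_neq[symmetric])
  qed (use y in \<open>auto intro: sqrt_radicand_integrable\<close>)
  then show ?thesis
    using y by (simp add: compl_E_eq[abs_def] at_within_open[of y "{0<..}"])
qed

lemma compl_K_DERIV:
  assumes y: "y > 0"
  shows "(compl_K has_real_derivative
    integral {0..pi/2} (\<lambda>t. - (y * (sin t)\<^sup>2 / (radicand y t * sqrt (radicand y
      t))))) (at y)"
proof -
  have "((\<lambda>y. integral (cbox 0 (pi/2)) (\<lambda>t. 1 / sqrt (radicand y t)))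
    has_real_derivative
      integral (cbox 0 (pi/2)) (\<lambda>t. - (y * (sin t)\<^sup>2 / (radicand y t * sqrt
        (radicand y t))))) (at y within {0<..})"
  proof (rule leibniz_rule_field_derivative)
    fix x t :: real assume "x \<in> {0<..}"
    then show "((\<lambda>y. 1 / sqrt (radicand y t)) has_real_derivative
        - (x * (sin t)\<^sup>2 / (radicand x t * sqrt (radicand x t)))) (at x within {0<..})"
      using radicand_pos[of x t]
      by (auto intro!: derivative_eq_intros DERIV_radicand_fst simp: field_simps)
  next
    show "continuous_on ({0<..} \<times> cbox 0 (pi / 2)) (\<lambda>(x, t). - (x * (sin
      t)\<^sup>2 / (radicand x t * sqrt (radicand x t))))"
      using radicand_pos unfolding split_beta
      by (intro continuous_intros) (auto simp: less_imp_neq[symmetric])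
  qed (use y in \<open>auto intro: inverse_sqrt_radicand_integrable\<close>)
  then show ?thesis
    using y by (simp add: compl_K_eq[abs_def] at_within_open[of y "{0<..}"])
qed

text \<open>Legendre's derivative formula, cleared of its denominator. The integrands agree
  pointwise because \<open>1 - radicand y t\<close> is
  \<open>(1 - y\<^sup>2) * (sin t)\<^sup>2\<close>.\<close>

lemma compl_E_derivative:
  assumes y: "y > 0"
  obtains D where "(compl_E has_real_derivative D) (at y)" "(1 - y\<^sup>2) * D = y * (compl_K y
    - compl_E y)"
proof (rule that[OF compl_E_DERIV[OF y]])
  have "y * (compl_K y - compl_E y) =
      integral {0..pi/2} (\<lambda>t. y * (1 / sqrt (radicand y t) - sqrt (radicand y t)))"
    unfolding compl_K_eq compl_E_eq
    by (simp add: integral_diff sqrt_radicand_integrable inverse_sqrt_radicand_integrable[OF y])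
  also have "\<dots> = integral {0..pi/2} (\<lambda>t. (1 - y\<^sup>2) * (y * (sin t)\<^sup>2 /
    sqrt (radicand y t)))"
  proof (rule integral_cong)
    fix t
    have s: "sqrt (radicand y t) > 0" using radicand_pos[OF y, of t] by simp
    have "1 / sqrt (radicand y t) - sqrt (radicand y t) = (1 - radicand y t) / sqrt (radicand y t)"
      using s radicand_pos[OF y, of t] by (simp add: field_simps)
    then show "y * (1 / sqrt (radicand y t) - sqrt (radicand y t)) =
        (1 - y\<^sup>2) * (y * (sin t)\<^sup>2 / sqrt (radicand y t))"
      by (simp add: radicand_def)
  qed
  finally show "(1 - y\<^sup>2) * integral {0..pi/2} (\<lambda>t. y * (sin t)\<^sup>2 / sqrt
    (radicand y t)) =
      y * (compl_K y - compl_E y)"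
    by (simp only: integral_mult_right)
qed

text \<open>The companion formula for K. Here the two integrands agree only up to an exact
  derivative.\<close>

lemma compl_K_derivative:
  assumes y: "y > 0"
  obtains D where "(compl_K has_real_derivative D) (at y)" "(1 - y\<^sup>2) * (y * D) = y\<^sup>2
    * compl_K y - compl_E y"
proof (rule that[OF compl_K_DERIV[OF y]])
  let ?R = "radicand y"
  let ?d = "\<lambda>t. - (y * (sin t)\<^sup>2 / (?R t * sqrt (?R t)))"
  have pos: "?R t > 0" for t using radicand_pos[OF y] .
  have int: "?d integrable_on {0..pi/2}"
    using pos by (intro integrable_continuous_interval continuous_intros) (auto simp:
      less_imp_neq[symmetric])
  \<comment> \<open>an antiderivative is \<open>(1 - y\<^sup>2) sin t cos t / sqrt (?R t)\<close>, which vanishes at both ends\<close>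
  have "((\<lambda>t. (1 - y\<^sup>2) * y * ?d t - (y\<^sup>2 * (1 / sqrt (?R t)) - sqrt (?R t)))
    has_integral
      (1 - y\<^sup>2) * (sin (pi/2) * cos (pi/2) / sqrt (?R (pi/2))) - (1 - y\<^sup>2) * (sin 0 *
        cos 0 / sqrt (?R 0))) {0..pi/2}"
  proof (rule fundamental_theorem_of_calculus)
    fix t
    \<comment> \<open>In terms of \<open>s\<close> the derivative is rational, and
      \<open>s\<^sup>2\<close> can be expanded by \<open>radicand_eq\<close>.\<close>
    define s where "s = sqrt (?R t)"
    have s: "s > 0" "?R t = s\<^sup>2" using pos[of t] by (auto simp: s_def)
    have "((\<lambda>t. (1 - y\<^sup>2) * (sin t * cos t / sqrt (?R t))) has_real_derivative
       (1 - y\<^sup>2) * (((cos t * cos t - sin t * sin t) * s - sin t * cos t * ((- 2 * (1 -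
         y\<^sup>2) * sin t * cos t) * (inverse s / 2))) / (s * s)))
       (at t within {0..pi/2})"
      using pos[of t] s(1) unfolding s_def
      by (auto intro!: derivative_eq_intros DERIV_radicand_snd simp: algebra_simps)
    also have "(1 - y\<^sup>2) * (((cos t * cos t - sin t * sin t) * s - sin t * cos t * ((- 2 *
      (1 - y\<^sup>2) * sin t * cos t) * (inverse s / 2))) / (s * s))
      = (1 - y\<^sup>2) * ((cos t)^2 - (sin t)^2) / s + (1 - y\<^sup>2)^2 * (sin t)^2 * (cos t)^2
        / s^3"
      using s(1) by (simp add: field_simps power2_eq_square power3_eq_cube)
    also have "\<dots> = (1 - y\<^sup>2) * (((cos t)^2 - (sin t)^2) * s\<^sup>2 + (1 - y\<^sup>2)
      * (sin t)^2 * (cos t)^2) / s^3"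
      using s(1) by (simp add: field_simps power2_eq_square power3_eq_cube)
    also have "(1 - y\<^sup>2) * (((cos t)^2 - (sin t)^2) * s\<^sup>2 + (1 - y\<^sup>2) * (sin
      t)^2 * (cos t)^2) =
        - (1 - y\<^sup>2) * y\<^sup>2 * (sin t)^2 - y\<^sup>2 * s\<^sup>2 + s\<^sup>2 * s\<^sup>2"
      unfolding s(2)[symmetric] radicand_eq using sin_cos_squared_add[of t] by algebra
    also have "(- (1 - y\<^sup>2) * y\<^sup>2 * (sin t)^2 - y\<^sup>2 * s\<^sup>2 + s\<^sup>2 *
      s\<^sup>2) / s ^ 3 =
       (1 - y\<^sup>2) * y * ?d t - (y\<^sup>2 * (1 / sqrt (?R t)) - sqrt (?R t))"
      using s(1) unfolding s_def[symmetric] s(2) by (simp add: field_simps power2_eq_square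
        power3_eq_cube)
    finally show "((\<lambda>t. (1 - y\<^sup>2) * (sin t * cos t / sqrt (?R t)))
      has_vector_derivative
       (1 - y\<^sup>2) * y * ?d t - (y\<^sup>2 * (1 / sqrt (?R t)) - sqrt (?R t))) (at t within
         {0..pi/2})"
      by (simp add: has_real_derivative_iff_has_vector_derivative)
  qed simp
  then have "integral {0..pi/2} (\<lambda>t. (1 - y\<^sup>2) * y * ?d t - (y\<^sup>2 * (1 / sqrt
    (?R t)) - sqrt (?R t))) = 0"
    by (simp add: has_integral_iff)
  moreover have "integral {0..pi/2} (\<lambda>t. (1 - y\<^sup>2) * y * ?d t - (y\<^sup>2 * (1 /
    sqrt (?R t)) - sqrt (?R t))) =
      (1 - y\<^sup>2) * y * integral {0..pi/2} ?d - (y\<^sup>2 * compl_K y - compl_E y)"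
    unfolding compl_K_eq compl_E_eq
    by (subst integral_diff integral_mult_right |
       (intro integrable_diff integrable_on_mult_right int sqrt_radicand_integrable
         inverse_sqrt_radicand_integrable y)[1])+ (rule refl)
  ultimately show "(1 - y\<^sup>2) * (y * integral {0..pi/2} ?d) = y\<^sup>2 * compl_K y -
    compl_E y"
    by simp
qed

section \<open>Bounds and continuity up to the endpoints\<close>

text \<open>Integrates \<open>y \<le> sqrt (radicand y t) \<le> 1\<close>. Both bounds agree at
  \<open>y = 1\<close>, near which the high moments concentrate.\<close>

lemma compl_E_bounds:
  assumes "0 \<le> y" "y \<le> 1"
  shows "pi / 2 * y \<le> compl_E y" "compl_E y \<le> pi / 2"
proof -
  have 1: "y \<le> sqrt (radicand y t)" "sqrt (radicand y t) \<le> 1" for t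
    using radicand_bounds[OF assms, of t] assms by (auto intro: real_le_rsqrt)
  have "integral {0..pi/2} (\<lambda>t. y) \<le> compl_E y" "compl_E y \<le> integral {0..pi/2}
    (\<lambda>t. 1)"
    unfolding compl_E_eq by (intro integral_le sqrt_radicand_integrable integrable_const_ivl 1)+
  then show "pi / 2 * y \<le> compl_E y" "compl_E y \<le> pi / 2"
    by simp_all
qed

lemma compl_K_bounds:
  assumes "0 < y" "y \<le> 1"
  shows "pi / 2 \<le> compl_K y" "y * compl_K y \<le> pi / 2"
proof -
  have 1: "y \<le> sqrt (radicand y t)" "sqrt (radicand y t) \<le> 1" "sqrt (radicand y t) > 0"
    for t
    using radicand_bounds[of y t] radicand_pos[of y t] assms by (auto intro: real_le_rsqrt)
  then have 2: "1 \<le> 1 / sqrt (radicand y t)" "1 / sqrt (radicand y t) \<le> 1 / y" for t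
    using assms 1[of t] by (auto simp: field_simps)
  have "integral {0..pi/2} (\<lambda>t. 1) \<le> compl_K y" "compl_K y \<le> integral {0..pi/2}
    (\<lambda>t. 1 / y)"
    unfolding compl_K_eq by (intro integral_le inverse_sqrt_radicand_integrable
      integrable_const_ivl 2 assms)+
  then show "pi / 2 \<le> compl_K y" "y * compl_K y \<le> pi / 2"
    using assms by (simp_all add: field_simps)
qed

lemma continuous_on_compl_E: "continuous_on S compl_E"
proof -
  have "continuous_on UNIV (\<lambda>y. integral (cbox 0 (pi/2)) (\<lambda>t. sqrt (radicand y t)))"
    by (rule integral_continuous_on_param) (auto simp: split_beta intro!: continuous_intros)
  then show ?thesis
    by (auto simp: compl_E_eq[abs_def] intro: continuous_on_subset)
qed

text \<open>K diverges at \<open>y = 0\<close>, but \<open>y * compl_K y\<close> stays bounded, so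
  one further factor \<open>y\<close> forces the limit 0.\<close>

lemma continuous_on_compl_K: "continuous_on {0..1} (\<lambda>y. y\<^sup>2 * compl_K y)"
proof -
  have "continuous (at y within {0..1}) (\<lambda>y. y\<^sup>2 * compl_K y)" if y: "y \<in>
    {0..1}" for y
  proof (cases "y = 0")
    case True
    have "((\<lambda>y. y\<^sup>2 * compl_K y) \<longlongrightarrow> 0) (at 0 within {0..1})"
    proof (rule Lim_null_comparison)
      show "\<forall>\<^sub>F y in at 0 within {0..1}. norm (y\<^sup>2 * compl_K y) \<le> y * (pi
        / 2)"
      proof (intro eventually_at_filter[THEN iffD2] always_eventually allI impI)
        fix y :: real assume "y \<noteq> 0" "y \<in> {0..1}"
        then have y: "0 < y" "y \<le> 1" by auto
        have "0 \<le> compl_K y" using compl_K_bounds(1)[OF y] pi_gt_zero by linarith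
        then have "norm (y\<^sup>2 * compl_K y) = y * (y * compl_K y)"
          using y by (simp add: power2_eq_square)
        also have "\<dots> \<le> y * (pi / 2)"
          using compl_K_bounds(2)[OF y] y by (intro mult_left_mono) auto
        finally show "norm (y\<^sup>2 * compl_K y) \<le> y * (pi / 2)" .
      qed
      show "((\<lambda>y. y * (pi / 2)) \<longlongrightarrow> 0) (at 0 within {0..1})"
        by (auto intro!: tendsto_eq_intros)
    qed
    then show ?thesis
      by (simp add: True continuous_within)
  next
    case False
    then have "y > 0" using y by simp
    then obtain D where "(compl_K has_real_derivative D) (at y)"
      using compl_K_DERIV by blast
    then have "continuous (at y within {0..1}) compl_K"
      using DERIV_isCont continuous_at_imp_continuous_at_within by blast
    then show ?thesis by (intro continuous_intros)
  qed
  then show ?thesis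
    by (simp add: continuous_on_eq_continuous_within)
qed

section \<open>Moments of the elliptic integrals\<close>

definition moment_E :: "nat \<Rightarrow> real" where
  "moment_E n = integral {0..1} (\<lambda>y. y ^ n * compl_E y)"

text \<open>The shift of the exponent by 2 makes the integrand continuous at 0.\<close>

definition moment_K :: "nat \<Rightarrow> real" where
  "moment_K n = integral {0..1} (\<lambda>y. y ^ n * (y\<^sup>2 * compl_K y))"

lemma moment_E_integrable: "(\<lambda>y. y ^ n * compl_E y) integrable_on {0..1}"
  by (intro integrable_continuous_interval continuous_intros continuous_on_compl_E)

lemma moment_K_integrable: "(\<lambda>y. y ^ n * (y\<^sup>2 * compl_K y)) integrable_on {0..1}"
  by (intro integrable_continuous_interval continuous_intros continuous_on_compl_K)

lemma moment_E_has_integral: "((\<lambda>y. y ^ n * compl_E y) has_integral moment_E n) {0..1}"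
  unfolding moment_E_def by (rule integrable_integral[OF moment_E_integrable])

lemma moment_K_has_integral: "((\<lambda>y. y ^ n * (y\<^sup>2 * compl_K y)) has_integral
  moment_K n) {0..1}"
  unfolding moment_K_def by (rule integrable_integral[OF moment_K_integrable])

lemma DERIV_power_mult_one_minus_square:
  "((\<lambda>y. y ^ (n + 1) * (1 - y\<^sup>2)) has_real_derivative
    real (n + 1) * y ^ n * (1 - y\<^sup>2) + y ^ (n + 1) * (- 2 * y)) (at y)"
proof (rule DERIV_cong[OF DERIV_mult[OF DERIV_pow]])
  show "((\<lambda>y. 1 - y\<^sup>2) has_real_derivative - 2 * y) (at y)"
    by (auto intro!: derivative_eq_intros)
qed simp

text \<open>Integrates the derivative of \<open>y ^ (n + 1) * (1 - y\<^sup>2) * compl_E y\<close>,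
  which vanishes at both ends. The factor \<open>1 - y\<^sup>2\<close> is the one that makes the
  derivative of E a combination of E and K. Differentiability is used only in the interior.\<close>

lemma moment_E_recurrence:
  "real (n + 4) * moment_E (n + 2) - real (n + 1) * moment_E n = moment_K n"
proof -
  let ?f = "\<lambda>y. real (n + 1) * (y ^ n * compl_E y) - real (n + 4) * (y ^ (n + 2) *
    compl_E y)
      + y ^ n * (y\<^sup>2 * compl_K y)"
  have "(?f has_integral (1 ^ (n + 1) * (1 - 1\<^sup>2) * compl_E 1 - 0 ^ (n + 1) * (1 -
    0\<^sup>2) * compl_E 0)) {0..1}"
  proof (rule fundamental_theorem_of_calculus_interior)
    show "continuous_on {0..1} (\<lambda>y. y ^ (n + 1) * (1 - y\<^sup>2) * compl_E y)"
      by (intro continuous_intros continuous_on_compl_E)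
    fix y :: real assume "y \<in> {0<..<1}"
    then have "y > 0" by simp
    then obtain D where D: "(compl_E has_real_derivative D) (at y)"
        "(1 - y\<^sup>2) * D = y * (compl_K y - compl_E y)"
      by (rule compl_E_derivative)
    have "((\<lambda>y. y ^ (n + 1) * (1 - y\<^sup>2) * compl_E y) has_real_derivative
        (real (n + 1) * y ^ n * (1 - y\<^sup>2) + y ^ (n + 1) * (- 2 * y)) * compl_E y + y ^ (n +
          1) * (1 - y\<^sup>2) * D) (at y)"
      by (rule DERIV_cong[OF DERIV_mult[OF DERIV_power_mult_one_minus_square D(1)]]) simp
    also have "y ^ (n + 1) * (1 - y\<^sup>2) * D = y ^ (n + 1) * (y * (compl_K y - compl_E y))"
      by (simp only: D(2) mult.assoc)
    also have "(real (n + 1) * y ^ n * (1 - y\<^sup>2) + y ^ (n + 1) * (- 2 * y)) * compl_E y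
        + y ^ (n + 1) * (y * (compl_K y - compl_E y)) = ?f y"
      by (simp add: algebra_simps power2_eq_square)
    finally show "((\<lambda>y. y ^ (n + 1) * (1 - y\<^sup>2) * compl_E y) has_vector_derivative
      ?f y) (at y)"
      by (simp only: has_real_derivative_iff_has_vector_derivative)
  qed simp
  then have zero: "(?f has_integral 0) {0..1}" by simp
  have "(?f has_integral (real (n + 1) * moment_E n - real (n + 4) * moment_E (n + 2) + moment_K
    n)) {0..1}"
    by (intro has_integral_add has_integral_diff has_integral_mult_right moment_E_has_integral
      moment_K_has_integral)
  from has_integral_unique[OF zero this] show ?thesis by simp
qed

text \<open>The same argument with \<open>y\<^sup>2 * compl_K y\<close> in place of
  \<open>compl_E y\<close>.\<close>

lemma moment_K_recurrence:
  "moment_E (n + 2) = real (n + 3) * moment_K n - real (n + 4) * moment_K (n + 2)"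
proof -
  let ?f = "\<lambda>y. real (n + 3) * (y ^ n * (y\<^sup>2 * compl_K y)) - real (n + 4) * (y ^ (n
    + 2) * (y\<^sup>2 * compl_K y))
      - y ^ (n + 2) * compl_E y"
  have "(?f has_integral (1 ^ (n + 1) * (1 - 1\<^sup>2) * (1\<^sup>2 * compl_K 1) - 0 ^ (n + 1) *
    (1 - 0\<^sup>2) * (0\<^sup>2 * compl_K 0))) {0..1}"
  proof (rule fundamental_theorem_of_calculus_interior)
    show "continuous_on {0..1} (\<lambda>y. y ^ (n + 1) * (1 - y\<^sup>2) * (y\<^sup>2 * compl_K
      y))"
      by (intro continuous_intros continuous_on_compl_K)
    fix y :: real assume "y \<in> {0<..<1}"
    then have "y > 0" by simp
    then obtain D where D: "(compl_K has_real_derivative D) (at y)"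
        "(1 - y\<^sup>2) * (y * D) = y\<^sup>2 * compl_K y - compl_E y"
      by (rule compl_K_derivative)
    have "((\<lambda>y. y ^ (n + 1) * (1 - y\<^sup>2) * (y\<^sup>2 * compl_K y)) has_real_derivative
        (real (n + 1) * y ^ n * (1 - y\<^sup>2) + y ^ (n + 1) * (- 2 * y)) * (y\<^sup>2 * compl_K
          y)
        + y ^ (n + 1) * (1 - y\<^sup>2) * (2 * y * compl_K y) + y ^ (n + 2) * ((1 - y\<^sup>2) *
          (y * D))) (at y)"
    proof (rule DERIV_cong[OF DERIV_mult[OF DERIV_power_mult_one_minus_square]])
      show "((\<lambda>y. y\<^sup>2 * compl_K y) has_real_derivative 2 * y * compl_K y + D *
        y\<^sup>2) (at y)"
        by (rule DERIV_cong[OF DERIV_mult[OF DERIV_pow D(1)]]) simp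
    qed (simp add: algebra_simps power2_eq_square)
    also have "(real (n + 1) * y ^ n * (1 - y\<^sup>2) + y ^ (n + 1) * (- 2 * y)) * (y\<^sup>2 *
      compl_K y)
        + y ^ (n + 1) * (1 - y\<^sup>2) * (2 * y * compl_K y) + y ^ (n + 2) * ((1 - y\<^sup>2) *
          (y * D)) = ?f y"
      unfolding D(2) by (simp add: algebra_simps power2_eq_square)
    finally show "((\<lambda>y. y ^ (n + 1) * (1 - y\<^sup>2) * (y\<^sup>2 * compl_K y))
      has_vector_derivative ?f y) (at y)"
      by (simp only: has_real_derivative_iff_has_vector_derivative)
  qed simp
  then have zero: "(?f has_integral 0) {0..1}" by simp
  have "(?f has_integral (real (n + 3) * moment_K n - real (n + 4) * moment_K (n + 2) - moment_E
    (n + 2))) {0..1}"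
    by (intro has_integral_diff has_integral_mult_right moment_E_has_integral moment_K_has_integral)
  from has_integral_unique[OF zero this] show ?thesis by simp
qed

lemma has_integral_power_01: "((\<lambda>y. y ^ n * c) has_integral c / real (Suc n)) {0..1}" for
  c :: real
proof -
  have "((\<lambda>y. y ^ n * c) has_integral (1 ^ Suc n * c / real (Suc n) - 0 ^ Suc n * c /
    real (Suc n))) {0..1}"
  proof (rule fundamental_theorem_of_calculus)
    fix y :: real
    have "((\<lambda>y. y ^ Suc n * c / real (Suc n)) has_real_derivative y ^ n * c) (at y within
      {0..1})"
      by (rule derivative_eq_intros refl | simp del: of_nat_Suc)+
    then show "((\<lambda>y. y ^ Suc n * c / real (Suc n)) has_vector_derivative y ^ n * c) (at y
      within {0..1})"
      by (simp only: has_real_derivative_iff_has_vector_derivative)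
  qed simp
  then show ?thesis by simp
qed

text \<open>Lower and upper bound are asymptotically equal. This fixes the constants that the
  recurrences leave open.\<close>

lemma moment_E_bounds:
  "pi / 2 / real (n + 2) \<le> moment_E n" "moment_E n \<le> pi / 2 / real (n + 1)"
proof -
  have "pi / 2 / real (Suc (Suc n)) \<le> moment_E n"
  proof (rule has_integral_le[OF has_integral_power_01 moment_E_has_integral])
    fix y :: real assume "y \<in> {0..1}"
    then have "y ^ n * (pi / 2 * y) \<le> y ^ n * compl_E y"
      by (intro mult_left_mono compl_E_bounds) auto
    then show "y ^ Suc n * (pi / 2) \<le> y ^ n * compl_E y" by (simp add: mult_ac)
  qed
  then show "pi / 2 / real (n + 2) \<le> moment_E n" by (simp add: add.commute)
  have "moment_E n \<le> pi / 2 / real (Suc n)"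
  proof (rule has_integral_le[OF moment_E_has_integral has_integral_power_01])
    show "y ^ n * compl_E y \<le> y ^ n * (pi / 2)" if "y \<in> {0..1}" for y
      using that by (intro mult_left_mono compl_E_bounds) auto
  qed
  then show "moment_E n \<le> pi / 2 / real (n + 1)" by simp
qed

lemma moment_K_bounds:
  "pi / 2 / real (n + 3) \<le> moment_K n" "moment_K n \<le> pi / 2 / real (n + 2)"
proof -
  have K: "pi / 2 * y\<^sup>2 \<le> y\<^sup>2 * compl_K y" "y\<^sup>2 * compl_K y \<le> pi / 2 *
    y" if "y \<in> {0..1}" for y
  proof -
    have "pi / 2 * y\<^sup>2 \<le> y\<^sup>2 * compl_K y \<and> y\<^sup>2 * compl_K y \<le> pi /
      2 * y"
    proof (cases "y = 0")
      case False
      then have y: "0 < y" "y \<le> 1" using that by auto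
      have "y\<^sup>2 * (pi / 2) \<le> y\<^sup>2 * compl_K y"
        by (intro mult_left_mono compl_K_bounds y) simp
      moreover have "y * (y * compl_K y) \<le> y * (pi / 2)"
        using y by (intro mult_left_mono compl_K_bounds) auto
      ultimately show ?thesis
        by (simp add: power2_eq_square mult_ac)
    qed simp
    then show "pi / 2 * y\<^sup>2 \<le> y\<^sup>2 * compl_K y" "y\<^sup>2 * compl_K y \<le> pi /
      2 * y" by auto
  qed
  have "pi / 2 / real (Suc (n + 2)) \<le> moment_K n"
  proof (rule has_integral_le[OF has_integral_power_01 moment_K_has_integral])
    fix y :: real assume y: "y \<in> {0..1}"
    then have "y ^ n * (pi / 2 * y\<^sup>2) \<le> y ^ n * (y\<^sup>2 * compl_K y)"
      by (intro mult_left_mono K) auto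
    then show "y ^ (n + 2) * (pi / 2) \<le> y ^ n * (y\<^sup>2 * compl_K y)" by (simp add:
      power2_eq_square mult_ac)
  qed
  then show "pi / 2 / real (n + 3) \<le> moment_K n" by (simp add: eval_nat_numeral)
  have "moment_K n \<le> pi / 2 / real (Suc (Suc n))"
  proof (rule has_integral_le[OF moment_K_has_integral has_integral_power_01])
    fix y :: real assume y: "y \<in> {0..1}"
    then have "y ^ n * (y\<^sup>2 * compl_K y) \<le> y ^ n * (pi / 2 * y)"
      by (intro mult_left_mono K) auto
    then show "y ^ n * (y\<^sup>2 * compl_K y) \<le> y ^ Suc n * (pi / 2)" by (simp add: mult_ac)
  qed
  then show "moment_K n \<le> pi / 2 / real (n + 2)" by (simp add: add.commute)
qed

text \<open>The two recurrences say only that the difference \<open>c n\<close> of both sides is invariant under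
  \<open>n \<mapsto> n + 2\<close>. It vanishes because both sides tend to \<open>\<pi>/2\<close>.\<close>

lemma moment_K_eq: "real (n + 3) * moment_K n = real (n + 4) * moment_E (n + 2)"
proof -
  define c where "c n = real (n + 3) * moment_K n - real (n + 4) * moment_E (n + 2)" for n
  have c_eq: "c n = real (n + 4) ^ 2 * moment_K (n + 2) - real (n + 3) ^ 2 * moment_K n" for n
    unfolding c_def moment_K_recurrence[of n] by (simp add: algebra_simps power2_eq_square)
  \<comment> \<open>Eliminating \<open>moment_E\<close> leaves a second order recurrence for
    \<open>moment_K\<close>, of which \<open>c\<close> is a first integral.\<close>
  have step: "c (n + 2) = c n" for n
    using moment_E_recurrence[of "n + 2"] moment_K_recurrence[of "n + 2"] moment_K_recurrence[of n]
    unfolding c_eq by (simp add: eval_nat_numeral) (simp add: algebra_simps)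
  have const: "c (n + 2 * j) = c n" for j
  proof (induction j)
    case (Suc j)
    have "c (n + 2 * Suc j) = c (n + 2 * j + 2)" by simp
    then show ?case using Suc step by simp
  qed simp
  \<comment> \<open>Both terms of \<open>c m\<close> lie between \<open>pi / 2\<close> and
    \<open>pi / 2 + pi / 2 / real (m + 2)\<close>.\<close>
  have bound: "\<bar>c m\<bar> \<le> pi / 2 / real (m + 2)" for m
  proof -
    have "real (m + 3) * moment_K m \<le> real (m + 3) * (pi / 2 / real (m + 2))"
      "real (m + 3) * (pi / 2 / real (m + 3)) \<le> real (m + 3) * moment_K m"
      by (intro mult_left_mono moment_K_bounds; simp)+
    moreover have "real (m + 3) * (pi / 2 / real (m + 2)) = pi / 2 + pi / 2 / real (m + 2)"
      "real (m + 3) * (pi / 2 / real (m + 3)) = pi / 2"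
      by (simp_all add: field_simps)
    moreover have "real (m + 4) * moment_E (m + 2) \<le> real (m + 4) * (pi / 2 / real (m + 2 + 1))"
      "real (m + 4) * (pi / 2 / real (m + 2 + 2)) \<le> real (m + 4) * moment_E (m + 2)"
      by (intro mult_left_mono moment_E_bounds; simp)+
    moreover have "real (m + 4) * (pi / 2 / real (m + 2 + 1)) = pi / 2 + pi / 2 / real (m + 3)"
      "real (m + 4) * (pi / 2 / real (m + 2 + 2)) = pi / 2"
      by (simp_all add: field_simps)
    moreover have "pi / 2 / real (m + 3) \<le> pi / 2 / real (m + 2)"
      by (intro divide_left_mono) auto
    ultimately show ?thesis unfolding c_def by linarith
  qed
  have "(\<lambda>j. pi / 2 / real (n + 2 * j + 2)) \<longlonglongrightarrow> 0"
    by real_asymp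
  moreover have "\<forall>j. \<bar>c n\<bar> \<le> pi / 2 / real (n + 2 * j + 2)"
    using bound[of "n + 2 * j" for j] const by simp
  ultimately have "\<bar>c n\<bar> \<le> 0"
    by (meson LIMSEQ_le_const)
  then show ?thesis by (simp add: c_def)
qed

text \<open>\<open>moment_K n\<close> is eliminated between \<open>moment_E_recurrence\<close> and
  \<open>moment_K_eq\<close>, so that E alone satisfies a first order recurrence in steps of
  two.\<close>

lemma moment_E_step:
  "real ((n + 2) * (n + 4)) * moment_E (n + 2) = real ((n + 1) * (n + 3)) * moment_E n"
proof -
  have "real (n + 3) * (real (n + 4) * moment_E (n + 2) - real (n + 1) * moment_E n) = real (n +
    4) * moment_E (n + 2)"
    by (simp only: moment_E_recurrence moment_K_eq)
  then show ?thesis by (simp add: algebra_simps)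
qed

lemma moment_K_via_E: "real (n + 2) * moment_K n = real (n + 1) * moment_E n"
proof -
  have "real (n + 3) * (real (n + 2) * moment_K n) = real (n + 2) * (real (n + 3) * moment_K n)"
    by simp
  also have "\<dots> = real (n + 3) * (real (n + 1) * moment_E n)"
    unfolding moment_K_eq using moment_E_step[of n] by (simp add: algebra_simps)
  finally show ?thesis by simp
qed

text \<open>By \<open>moment_E_step\<close> the product of
  \<open>real (j + 1) * moment_E (2 * j)\<close> with the partial Wallis product \<open>W j\<close>
  is constant in \<open>j\<close>. The first factor tends to \<open>pi / 4\<close> by the bounds,
  the second to \<open>pi / 2\<close>.\<close>

lemma moment_E_0: "moment_E 0 = pi\<^sup>2 / 8"
proof -
  define W where "W j = (\<Prod>k=1..j. (4 * real k ^ 2) / (4 * real k ^ 2 - 1))" for j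
  have eq: "(real (j + 1) * moment_E (2 * j)) * W j = moment_E 0" for j
  proof (induction j)
    case (Suc j)
    define x where "x = real j"
    have x: "x \<ge> 0" by (simp add: x_def)
    have E: "(2 * x + 2) * (2 * x + 4) * moment_E (2 * j + 2) = (2 * x + 1) * (2 * x + 3) *
      moment_E (2 * j)"
      using moment_E_step[of "2 * j"] by (simp add: x_def algebra_simps)
    have W: "W (Suc j) = W j * (4 * (x + 1) ^ 2 / (4 * (x + 1) ^ 2 - 1))"
      by (simp add: W_def x_def add.commute)
    have 4: "4 * (x + 1) ^ 2 - 1 = (2 * x + 1) * (2 * x + 3)"
      by (simp add: algebra_simps power2_eq_square)
    have "(real (Suc j + 1) * moment_E (2 * Suc j)) * W (Suc j) =
       ((2 * x + 2) * (2 * x + 4) * moment_E (2 * j + 2)) * (x + 1) * W j / ((2 * x + 1) * (2 * x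
         + 3))"
      unfolding W 4 by (simp add: x_def[symmetric]) (simp add: field_simps power2_eq_square)
    also have "\<dots> = (x + 1) * moment_E (2 * j) * W j"
    proof -
      have "2 * x + 1 \<noteq> 0" "2 * x + 3 \<noteq> 0" using x by auto
      then show ?thesis unfolding E by simp
    qed
    finally show ?case using Suc by (simp add: x_def add.commute)
  qed (simp add: W_def)
  have "(\<lambda>j. real (j + 1) * moment_E (2 * j)) \<longlonglongrightarrow> pi / 4"
  proof (rule tendsto_sandwich)
    show "\<forall>\<^sub>F j in sequentially. real (j + 1) * (pi / 2 / real (2 * j + 2)) \<le>
      real (j + 1) * moment_E (2 * j)"
      by (intro always_eventually allI mult_left_mono moment_E_bounds) simp
    show "\<forall>\<^sub>F j in sequentially. real (j + 1) * moment_E (2 * j) \<le> real (j + 1)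
      * (pi / 2 / real (2 * j + 1))"
      by (intro always_eventually allI mult_left_mono moment_E_bounds) simp
  qed real_asymp+
  moreover have "W \<longlonglongrightarrow> pi / 2"
    unfolding W_def by (rule wallis)
  ultimately have "(\<lambda>j. (real (j + 1) * moment_E (2 * j)) * W j)
    \<longlonglongrightarrow> pi / 4 * (pi / 2)"
    by (rule tendsto_mult)
  then have "moment_E 0 = pi / 4 * (pi / 2)"
    unfolding eq by (simp add: LIMSEQ_const_iff)
  then show ?thesis by (simp add: power2_eq_square)
qed

section \<open>The density of the trace\<close>

text \<open>The right-hand side of the theorem at \<open>m = 1 - y\<^sup>2\<close>: there
  \<open>m\<^sup>2 - 16 * m + 16\<close> is \<open>y ^ 4 + 14 * y\<^sup>2 + 1\<close>, and
  \<open>m\<^sup>2 - 3 * m + 2 = (2 - m) * (1 - m)\<close> is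
  \<open>(1 + y\<^sup>2) * y\<^sup>2\<close>.\<close>

definition elliptic_combination :: "real \<Rightarrow> real" where
  "elliptic_combination y =
     (y ^ 4 + 14 * y\<^sup>2 + 1) * compl_E y - 8 * ((1 + y\<^sup>2) * (y\<^sup>2 * compl_K y))"

lemma continuous_on_elliptic_combination: "continuous_on {0..1} elliptic_combination"
  unfolding elliptic_combination_def[abs_def]
  by (intro continuous_intros continuous_on_compl_E continuous_on_compl_K)

text \<open>At \<open>y = 0\<close> both K terms are 0, one by the factor \<open>y\<^sup>2\<close>,
  the other by the case \<open>m = 1\<close> of \<open>ellipticK_term\<close>.\<close>

lemma elliptic_combination_eq:
  "elliptic_combination y =
     ((1 - y\<^sup>2)\<^sup>2 - 16 * (1 - y\<^sup>2) + 16) * ellipticE (1 - y\<^sup>2) - 8 *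
       ellipticK_term (1 - y\<^sup>2)"
  by (simp add: elliptic_combination_def ellipticK_term_def compl_E_def compl_K_def algebra_simps
      power2_eq_square power4_eq_xxxx)

definition moment_comb :: "nat \<Rightarrow> real" where
  "moment_comb n = integral {0..1} (\<lambda>y. y ^ n * elliptic_combination y)"

lemma moment_comb_has_integral:
  "((\<lambda>y. y ^ n * elliptic_combination y) has_integral moment_comb n) {0..1}"
  unfolding moment_comb_def
  by (intro integrable_integral integrable_continuous_interval continuous_intros
    continuous_on_elliptic_combination)

text \<open>All five moments that occur are rational multiples of \<open>moment_E n\<close>. For
  this combination the numerator collapses to the constant 45.\<close>

lemma moment_comb_closed_form:
  "real ((n + 2) * (n + 4)\<^sup>2 * (n + 6)) * moment_comb n = 45 * moment_E n"
proof -
  have "((\<lambda>y. y ^ (n + 4) * compl_E y + 14 * (y ^ (n + 2) * compl_E y) + y ^ n * compl_E y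
      - 8 * (y ^ n * (y\<^sup>2 * compl_K y) + y ^ (n + 2) * (y\<^sup>2 * compl_K y))) has_integral
      moment_E (n + 4) + 14 * moment_E (n + 2) + moment_E n - 8 * (moment_K n + moment_K (n +
        2))) {0..1}"
    by (intro has_integral_add has_integral_diff has_integral_mult_right moment_E_has_integral
      moment_K_has_integral)
  also have "(\<lambda>y. y ^ (n + 4) * compl_E y + 14 * (y ^ (n + 2) * compl_E y) + y ^ n *
    compl_E y
      - 8 * (y ^ n * (y\<^sup>2 * compl_K y) + y ^ (n + 2) * (y\<^sup>2 * compl_K y))) =
      (\<lambda>y. y ^ n * elliptic_combination y)"
    by (rule ext) (simp add: elliptic_combination_def power_add power2_eq_square power4_eq_xxxx
      algebra_simps)
  finally have q: "moment_comb n =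
      moment_E (n + 4) + 14 * moment_E (n + 2) + moment_E n - 8 * (moment_K n + moment_K (n + 2))"
    using moment_comb_has_integral has_integral_unique by blast
  define a where "a = real n"
  define e0 e2 e4 k0 k2 where d: "e0 = moment_E n" "e2 = moment_E (n + 2)" "e4 = moment_E (n + 4)"
    "k0 = moment_K n" "k2 = moment_K (n + 2)"
  have nn: "n + 2 + 2 = n + 4" "n + 2 + 4 = n + 6" "n + 2 + 1 = n + 3" "n + 2 + 3 = n + 5" by
    simp_all
  have 1: "(a + 2) * (a + 4) * e2 = (a + 1) * (a + 3) * e0"
    using moment_E_step[of n] by (simp add: d a_def algebra_simps)
  have 2: "(a + 4) * (a + 6) * e4 = (a + 3) * (a + 5) * e2"
    using moment_E_step[of "n + 2"] unfolding nn d a_def by simp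
  have 3: "(a + 2) * k0 = (a + 1) * e0"
    using moment_K_via_E[of n] by (simp add: d a_def algebra_simps)
  have 4: "(a + 4) * k2 = (a + 3) * e2"
    using moment_K_via_E[of "n + 2"] unfolding nn d a_def by simp
  have "(a + 2) * (a + 4)\<^sup>2 * (a + 6) * (e4 + 14 * e2 + e0 - 8 * (k0 + k2)) = 45 * e0"
    using 1 2 3 4 by algebra
  then show ?thesis
    unfolding q d a_def by (simp add: algebra_simps)
qed

text \<open>The quotient of the closed forms at \<open>n + 2\<close> and \<open>n\<close>, with
  \<open>moment_E_step\<close> for the quotient of the E moments.\<close>

lemma moment_comb_step:
  "real ((n + 6) * (n + 8)) * moment_comb (n + 2) = real ((n + 1) * (n + 3)) * moment_comb n"
proof -
  define a where "a = real n"
  have a: "a \<ge> 0" by (simp add: a_def)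
  have nn: "n + 2 + 2 = n + 4" "n + 2 + 4 = n + 6" "n + 2 + 6 = n + 8" by simp_all
  have 1: "(a + 4) * (a + 6)\<^sup>2 * (a + 8) * moment_comb (n + 2) = 45 * moment_E (n + 2)"
    using moment_comb_closed_form[of "n + 2"] unfolding nn a_def by simp
  have 2: "(a + 2) * (a + 4)\<^sup>2 * (a + 6) * moment_comb n = 45 * moment_E n"
    using moment_comb_closed_form[of n] by (simp add: a_def algebra_simps)
  have 3: "(a + 2) * (a + 4) * moment_E (n + 2) = (a + 1) * (a + 3) * moment_E n"
    using moment_E_step[of n] by (simp add: a_def algebra_simps)
  have "((a + 2) * (a + 4)\<^sup>2 * (a + 6)) * ((a + 6) * (a + 8) * moment_comb (n + 2)) =
      ((a + 2) * (a + 4)\<^sup>2 * (a + 6)) * ((a + 1) * (a + 3) * moment_comb n)"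
    using 1 2 3 by algebra
  moreover have "(a + 2) * (a + 4)\<^sup>2 * (a + 6) \<noteq> 0"
    using a by simp
  ultimately have "(a + 6) * (a + 8) * moment_comb (n + 2) = (a + 1) * (a + 3) * moment_comb n"
    using mult_left_cancel by blast
  then show ?thesis
    by (simp only: a_def of_nat_mult of_nat_add of_nat_numeral of_nat_1)
qed

lemma moment_comb_0: "moment_comb 0 = 15 * pi\<^sup>2 / 512"
  using moment_comb_closed_form[of 0] by (simp add: moment_E_0)

text \<open>The claimed formula solved for the density; the absolute value makes \<open>y\<close>
  the nonnegative root of \<open>1 - m\<close>.\<close>

definition elliptic_density :: "real \<Rightarrow> real" where
  "elliptic_density x = 64 / (15 * pi\<^sup>2) * elliptic_combination (\<bar>x\<bar> / 4)"

lemma continuous_on_elliptic_density: "continuous_on {-4..4} elliptic_density"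
  unfolding elliptic_density_def[abs_def]
  by (intro continuous_intros continuous_on_compose2[OF continuous_on_elliptic_combination]) auto

definition moment_density :: "nat \<Rightarrow> real" where
  "moment_density n = integral {-4..4} (\<lambda>x. x ^ n * elliptic_density x)"

text \<open>Substitute \<open>x = 4 y\<close> on \<open>{0..4}\<close>, which gives
  \<open>4 ^ n\<close> from the power and 4 from the differential, and reflect for the other half,
  the density being even.\<close>

lemma moment_density_eq:
  "moment_density n = (1 + (-1) ^ n) * (64 / (15 * pi\<^sup>2)) * 4 ^ (n + 1) * moment_comb n"
proof -
  define I where "I = 64 / (15 * pi\<^sup>2) * 4 ^ (n + 1) * moment_comb n"
  have "((\<lambda>x. (1 / 4 * x) ^ n * elliptic_combination (1 / 4 * x)) has_integral
      (1 / \<bar>1 / 4\<bar>) *\<^sub>R moment_comb n) ((\<lambda>x. x / (1 / 4)) ` {0..1})"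
    by (rule has_integral_stretch_real[OF moment_comb_has_integral]) simp
  moreover have "(\<lambda>x::real. x / (1 / 4)) ` {0..1} = {0..4}"
    using image_mult_atLeastAtMost[of 4 0 "1::real"] by (simp add: mult.commute)
  ultimately have "((\<lambda>x. (1 / 4 * x) ^ n * elliptic_combination (1 / 4 * x)) has_integral
    4 * moment_comb n) {0..4}"
    by simp
  then have "((\<lambda>x. 64 / (15 * pi\<^sup>2) * 4 ^ n * ((1 / 4 * x) ^ n *
    elliptic_combination (1 / 4 * x)))
      has_integral 64 / (15 * pi\<^sup>2) * 4 ^ n * (4 * moment_comb n)) {0..4}"
    by (rule has_integral_mult_right)
  then have "((\<lambda>x. 64 / (15 * pi\<^sup>2) * 4 ^ n * ((1 / 4 * x) ^ n *
    elliptic_combination (1 / 4 * x))) has_integral I) {0..4}"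
    by (simp add: I_def mult.assoc)
  then have pos: "((\<lambda>x. x ^ n * elliptic_density x) has_integral I) {0..4}"
    by (rule has_integral_eq[rotated]) (simp add: elliptic_density_def power_divide)
  then have "((\<lambda>x. (- 1) ^ n * (x ^ n * elliptic_density x)) has_integral (- 1) ^ n * I)
    {0..4}"
    by (rule has_integral_mult_right)
  also have "(\<lambda>x. (- 1) ^ n * (x ^ n * elliptic_density x)) = (\<lambda>x. (- x) ^ n *
    elliptic_density (- x))"
  proof (rule ext)
    show "(- 1) ^ n * (x ^ n * elliptic_density x) = (- x) ^ n * elliptic_density (- x)" for x
      by (simp only: elliptic_density_def power_minus[of x n] abs_minus_cancel mult.assoc)
  qed
  finally have "((\<lambda>x. (- x) ^ n * elliptic_density (- x)) has_integral (- 1) ^ n * I) {-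
    0..- (- 4)}"
    by simp
  then have "((\<lambda>x. x ^ n * elliptic_density x) has_integral (- 1) ^ n * I) {- 4..0}"
    by (rule has_integral_reflect_real[where f = "\<lambda>x. x ^ n * elliptic_density x", THEN
      iffD1])
  from has_integral_combine[OF _ _ this pos] have "moment_density n = (- 1) ^ n * I + I"
    by (simp add: moment_density_def has_integral_iff)
  then show ?thesis
    by (simp add: I_def algebra_simps add_divide_distrib)
qed

text \<open>The total mass is \<open>2 * 4 * 64 / (15 * pi\<^sup>2)\<close> times
  \<open>15 * pi\<^sup>2 / 512\<close>. The factor 16 in the recurrence comes from
  \<open>4 ^ (n + 1)\<close>.\<close>

lemma moment_density_recurrence:
  "moment_density 0 = 1" "moment_density 1 = 0"
  "real ((n + 6) * (n + 8)) * moment_density (n + 2) = real (16 * (n + 1) * (n + 3)) *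
    moment_density n"
proof -
  show "moment_density 0 = 1" "moment_density 1 = 0"
    by (simp_all add: moment_density_eq moment_comb_0)
  define c where "c = (1 + (-1) ^ n) * (64 / (15 * pi\<^sup>2)) * 4 ^ (n + 1)"
  have "moment_density (n + 2) = 16 * c * moment_comb (n + 2)"
    by (simp add: moment_density_eq c_def)
  then have "real ((n + 6) * (n + 8)) * moment_density (n + 2) =
      16 * c * (real ((n + 6) * (n + 8)) * moment_comb (n + 2))"
    by (simp only: mult_ac)
  also have "\<dots> = real (16 * (n + 1) * (n + 3)) * (c * moment_comb n)"
    unfolding moment_comb_step by (simp add: algebra_simps)
  also have "c * moment_comb n = moment_density n"
    by (simp only: moment_density_eq c_def)
  finally show "real ((n + 6) * (n + 8)) * moment_density (n + 2) = real (16 * (n + 1) * (n + 3))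
    * moment_density n" .
qed

section \<open>Uniqueness: two-step recurrences and the moment problem on an interval\<close>

lemma two_step_recurrence_unique:
  fixes a b :: "nat \<Rightarrow> real"
  assumes "a 0 = b 0" "a 1 = b 1"
    and "\<And>n. p n * a (n + 2) = q n * a n" "\<And>n. p n * b (n + 2) = q n * b n" "\<And>n. p
      n \<noteq> 0"
  shows "a n = b n"
proof (induction n rule: less_induct)
  case (less n)
  consider "n = 0" | "n = 1" | k where "n = k + 2"
    by (metis One_nat_def add_2_eq_Suc' not0_implies_Suc)
  then show ?case
  proof cases
    case 3
    then have "p k * a n = p k * b n"
      using assms(3)[of k] assms(4)[of k] less[of k] by simp
    then show ?thesis using assms(5)[of k] by simp
  qed (use assms in auto)
qed

text \<open>The difference \<open>d\<close> is orthogonal to all polynomials. With a polynomial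
  \<open>p\<close> uniformly within \<open>e\<close> of \<open>d\<close>, the integral of
  \<open>d * d\<close> equals that of \<open>(d - p) * d\<close> and is at most \<open>e\<close>
  times the integral of \<open>\<bar>d\<bar>\<close>.\<close>

lemma continuous_eq_if_moments_eq:
  fixes f g :: "real \<Rightarrow> real"
  assumes "a < b" and cont: "continuous_on {a..b} f" "continuous_on {a..b} g"
    and moments: "\<And>n. integral {a..b} (\<lambda>x. x ^ n * f x) = integral {a..b}
      (\<lambda>x. x ^ n * g x)"
    and x: "x \<in> {a..b}"
  shows "f x = g x"
proof -
  define d where "d x = f x - g x" for x
  have d: "continuous_on {a..b} d"
    unfolding d_def by (intro continuous_intros cont)
  have int: "(\<lambda>x. h x * k x) integrable_on {a..b}" if "continuous_on {a..b} h"
    "continuous_on {a..b} k"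
    for h k :: "real \<Rightarrow> real"
    by (intro integrable_continuous_interval continuous_intros that)
  have pow0: "integral {a..b} (\<lambda>x. x ^ n * d x) = 0" for n
    unfolding d_def using moments[of n]
    by (simp add: right_diff_distrib integral_diff int cont continuous_intros)
  have poly0: "integral {a..b} (\<lambda>x. p x * d x) = 0" if p: "real_polynomial_function p" for p
  proof -
    obtain c n where p: "p = (\<lambda>x. \<Sum>i\<le>n. c i * x ^ i)"
      using real_polynomial_function_imp_sum[OF p] by auto
    have "integral {a..b} (\<lambda>x. \<Sum>i\<le>n. c i * (x ^ i * d x)) = (\<Sum>i\<le>n.
      integral {a..b} (\<lambda>x. c i * (x ^ i * d x)))"
      by (intro integral_sum integrable_on_mult_right int d continuous_intros) simp
    then show ?thesis
      unfolding p by (simp add: pow0 sum_distrib_right mult.assoc)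
  qed
  define B where "B = integral {a..b} (\<lambda>x. \<bar>d x\<bar>)"
  have B: "B \<ge> 0"
    unfolding B_def by (intro integral_nonneg integrable_continuous_interval continuous_intros d)
      simp
  have le: "integral {a..b} (\<lambda>x. d x * d x) \<le> e * B" if e: "e > 0" for e
  proof -
    obtain p where p: "real_polynomial_function p" "\<And>x. x \<in> {a..b} \<Longrightarrow>
      \<bar>d x - p x\<bar> < e"
      using Stone_Weierstrass_real_polynomial_function[OF compact_Icc d e] by blast
    have cp: "continuous_on {a..b} p"
      using continuous_real_polymonial_function[OF p(1)] continuous_at_imp_continuous_on by blast
    have "integral {a..b} (\<lambda>x. d x * d x) = integral {a..b} (\<lambda>x. (d x - p x) * d x)"
      using poly0[OF p(1)] by (simp add: left_diff_distrib integral_diff int d cp)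
    also have "\<dots> \<le> integral {a..b} (\<lambda>x. e * \<bar>d x\<bar>)"
    proof (intro integral_le int integrable_continuous_interval continuous_intros d cp)
      fix x assume "x \<in> {a..b}"
      then have "\<bar>d x - p x\<bar> * \<bar>d x\<bar> \<le> e * \<bar>d x\<bar>"
        using p(2)[of x] by (intro mult_right_mono) auto
      then show "(d x - p x) * d x \<le> e * \<bar>d x\<bar>"
        by (metis abs_le_D1 abs_mult)
    qed
    also have "\<dots> = e * B" by (simp add: B_def)
    finally show ?thesis .
  qed
  have "integral {a..b} (\<lambda>x. d x * d x) \<le> 0"
  proof (rule field_le_epsilon)
    fix e :: real assume "e > 0"
    \<comment> \<open>The denominator is \<open>B + 1\<close> because \<open>B\<close> may be
      0.\<close>
    then have "integral {a..b} (\<lambda>x. d x * d x) \<le> e / (B + 1) * B"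
      using B by (intro le) simp
    also have "\<dots> \<le> e" using B \<open>e > 0\<close> by (simp add: field_simps)
    finally show "integral {a..b} (\<lambda>x. d x * d x) \<le> 0 + e" by simp
  qed
  moreover have "integral {a..b} (\<lambda>x. d x * d x) \<ge> 0"
    by (intro integral_nonneg int d) simp
  ultimately have "integral {a..b} (\<lambda>x. d x * d x) = 0" by simp
  moreover have "continuous_on {a..b} (\<lambda>x. d x * d x)"
    by (intro continuous_intros d)
  ultimately have "\<forall>x\<in>{a..b}. d x * d x = 0"
    using integral_eq_0_iff[of a b "\<lambda>x. d x * d x"] \<open>a < b\<close> by simp
  then show ?thesis using x by (simp add: d_def)
qed

theorem corollary5p6:
  fixes M :: "(complex^4^4) measure" and f :: "real \<Rightarrow> real" and x m :: real
  assumes "is_normalized_haar USp4 M"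
    and "is_trace_density M f"
    and "\<bar>x\<bar> < 4"
    and "m = 1 - x\<^sup>2 / 16"
  shows "15 / 64 * pi\<^sup>2 * f x =
           (m\<^sup>2 - 16 * m + 16) * ellipticE m - 8 * ellipticK_term m"
proof -
  have f: "continuous_on {-4..4} f"
    and moments: "(\<integral>g. tau g ^ n \<partial>M) = integral {-4..4} (\<lambda>x. x ^ n * f
      x)" for n
    using assms(2) continuous_on_power[OF continuous_on_id, of "{-4..4::real}" n]
    by (auto simp: is_trace_density_def)
  \<comment> \<open>Both moment sequences start with 1, 0 and obey the same recurrence.\<close>
  have "(\<integral>g. tau g ^ n \<partial>M) = moment_density n" for n
  proof (rule two_step_recurrence_unique[where p = "\<lambda>n. real ((n + 6) * (n + 8))"
        and q = "\<lambda>n. real (16 * (n + 1) * (n + 3))"])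
    show "real ((n + 6) * (n + 8)) \<noteq> 0" for n
      by (simp only: of_nat_eq_0_iff) simp
  qed (simp_all only: USp4_tau_moments[OF assms(1)] moment_density_recurrence)
  \<comment> \<open>Both functions are continuous on the closed interval, so equality of moments
    gives equality at every point.\<close>
  then have "f x = elliptic_density x"
    using assms(3) moments
    by (intro continuous_eq_if_moments_eq[OF _ f continuous_on_elliptic_density])
      (auto simp: moment_density_def)
  moreover have "m = 1 - (\<bar>x\<bar> / 4)\<^sup>2"
    using assms(4) by (simp add: power_divide)
  ultimately show ?thesis
    by (simp add: elliptic_density_def elliptic_combination_eq)
qed

end
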